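(* Let $X=(X_1,\dots,X_n)$ be a Gaussian vector with $X\sim\mathcal{N}(0,\mathbf{I}_n)$. Introduce the class of polynomials on $\mathbb{R}^n$ $$\mathcal{C}=\left\{\sum_{k=1}^m F_k^2\ \Big|\ m\ge 1,\ F_k\in\mathrm{Ker}(\mathcal{L}+k\,\mathbf{Id})\right\}.$$ Given $q$ polynomials $P_1,\dots,P_q$ in the class $\mathcal{C}$ such that the random variables $P_1(X),\dots,P_q(X)$ are pairwise independent, there exist an isometry $T$ of $\mathbb{R}^n$ and a collection $(E_i)_{1\le i\le q}$ of pairwise disjoint subsets of $\{1,\dots,n\}$ such that, for all $1\le i\le q$, $P_i(X)\in\mathbb{R}[Y_j,\ j\in E_i]$, where $Y=(Y_1,\dots,Y_n)=T(X)$.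
   Context: $\mathcal{L}f=\Delta f-\langle x,\nabla f\rangle$ is the Ornstein-Uhlenbeck generator on $\mathbb{R}^n$ and $\mathbf{Id}$ is the identity operator. With the Hermite polynomials $H_0\equiv 1$, $H_{k+1}(x)=xH_k(x)-H_k'(x)$, the space $\mathrm{Ker}(\mathcal{L}+k\,\mathbf{Id})$ (the $k$th Wiener chaos) is the space of polynomials of the form $\sum_{i_1+\cdots+i_n=k}\alpha(i_1,\dots,i_n)\prod_{j=1}^n H_{i_j}(x_j)$ with real coefficients $\alpha(i_1,\dots,i_n)$. $\mathbb{R}[Y_j,\ j\in E]$ denotes the set of real polynomials in the variables $Y_j$, $j\in E$. *)

theory Defs
  imports "HOL-Probability.Probability" "HOL-Computational_Algebra.Polynomial"
begin

text \<open>
  Points of \<open>\<real>\<^sup>n\<close> are elements of \<^typ>\<open>real ^ 'n\<close>, the index set \<open>{1, \<dots>, n}\<close> being the finite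
  type \<^typ>\<open>'n\<close>.  Polynomials on \<open>\<real>\<^sup>n\<close> are polynomial functions; over \<open>\<real>\<close> nothing is lost
  by identifying the two.
\<close>

definition partial_deriv :: "'n \<Rightarrow> (real ^ 'n \<Rightarrow> real) \<Rightarrow> real ^ 'n \<Rightarrow> real" where
  "partial_deriv j f x = deriv (\<lambda>t. f (x + t *\<^sub>R axis j 1)) 0"

definition grad :: "(real ^ 'n \<Rightarrow> real) \<Rightarrow> real ^ 'n \<Rightarrow> real ^ 'n" where
  "grad f x = (\<chi> j. partial_deriv j f x)"

definition laplacian :: "(real ^ 'n \<Rightarrow> real) \<Rightarrow> real ^ 'n \<Rightarrow> real" where
  "laplacian f x = (\<Sum>j\<in>UNIV. partial_deriv j (partial_deriv j f) x)"

definition OU :: "(real ^ 'n \<Rightarrow> real) \<Rightarrow> real ^ 'n \<Rightarrow> real" where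
  "OU f x = laplacian f x - x \<bullet> grad f x"

text \<open>
  The domain of the generator is taken to be the polynomials.  Without a growth condition the
  kernel of \<open>\<L> + k Id\<close> on smooth functions would be too large; on polynomials it is exactly the
  \<open>k\<close>th Wiener chaos, see \<open>OU_ker_eq_wiener_chaos\<close> below.
\<close>

definition OU_ker :: "nat \<Rightarrow> (real ^ 'n \<Rightarrow> real) set" where
  "OU_ker k = {F. real_polynomial_function F \<and> (\<forall>x. OU F x + real k * F x = 0)}"

definition class_C :: "(real ^ 'n \<Rightarrow> real) set" where
  "class_C = {P. \<exists>m\<ge>1. \<exists>F :: nat \<Rightarrow> real ^ 'n \<Rightarrow> real.
     (\<forall>k\<in>{1..m}. F k \<in> OU_ker k) \<and> P = (\<lambda>x. \<Sum>k=1..m. (F k x)\<^sup>2)}"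

definition std_gaussian_density :: "real ^ 'n \<Rightarrow> real" where
  "std_gaussian_density x = exp (- (norm x)\<^sup>2 / 2) / sqrt (2 * pi) ^ CARD('n)"

text \<open>
  \<open>\<real>[Y\<^sub>j, j \<in> E]\<close> for real-valued functions (random variables) \<open>Y\<^sub>j\<close>: the smallest set of
  functions that contains the constants and all \<open>Y\<^sub>j\<close> with \<open>j \<in> E\<close> and is closed under sums
  and products.
\<close>

inductive_set real_polys :: "('j \<Rightarrow> 'a \<Rightarrow> real) \<Rightarrow> 'j set \<Rightarrow> ('a \<Rightarrow> real) set"
  for Y :: "'j \<Rightarrow> 'a \<Rightarrow> real" and E :: "'j set" where
  const: "(\<lambda>\<omega>. c) \<in> real_polys Y E"
| var: "j \<in> E \<Longrightarrow> Y j \<in> real_polys Y E"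
| add: "f \<in> real_polys Y E \<Longrightarrow> g \<in> real_polys Y E \<Longrightarrow> (\<lambda>\<omega>. f \<omega> + g \<omega>) \<in> real_polys Y E"
| mult: "f \<in> real_polys Y E \<Longrightarrow> g \<in> real_polys Y E \<Longrightarrow> (\<lambda>\<omega>. f \<omega> * g \<omega>) \<in> real_polys Y E"


section \<open>The kernels are the Wiener chaoses\<close>

fun hermite :: "nat \<Rightarrow> real poly" where
  "hermite 0 = 1"
| "hermite (Suc k) = [:0, 1:] * hermite k - pderiv (hermite k)"

definition hermite_prod :: "('n \<Rightarrow> nat) \<Rightarrow> real ^ 'n \<Rightarrow> real" where
  "hermite_prod i x = (\<Prod>j\<in>UNIV. poly (hermite (i j)) (x $ j))"

definition wiener_chaos :: "nat \<Rightarrow> (real ^ 'n \<Rightarrow> real) set" where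
  "wiener_chaos k = {F. \<exists>\<alpha> :: ('n \<Rightarrow> nat) \<Rightarrow> real.
     F = (\<lambda>x. \<Sum>i | (\<Sum>j\<in>UNIV. i j) = k. \<alpha> i * hermite_prod i x)}"

lemma pderiv_hermite_Suc: "pderiv (hermite (Suc k)) = smult (real (Suc k)) (hermite k)"
proof (induction k)
  case 0
  show ?case by (simp add: pderiv_pCons)
next
  case (Suc k)
  have "pderiv (hermite (Suc (Suc k)))
      = hermite (Suc k) + [:0, 1:] * pderiv (hermite (Suc k)) - pderiv (pderiv (hermite (Suc k)))"
    unfolding hermite.simps(2)[of "Suc k"] by (simp add: pderiv_diff pderiv_mult pderiv_pCons)
  also have "\<dots> = hermite (Suc k) + smult (real (Suc k)) ([:0, 1:] * hermite k - pderiv (hermite k))"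
    unfolding Suc by (simp only: pderiv_smult mult_smult_right smult_diff_right add_diff_eq)
  also have "\<dots> = smult (real (Suc (Suc k))) (hermite (Suc k))"
    unfolding hermite.simps(2)[symmetric] by (simp only: smult_add_left[symmetric] of_nat_Suc)
      (metis smult_1_left smult_add_left)
  finally show ?case .
qed

lemma hermite_ode:
  "poly (pderiv (pderiv (hermite k))) t - t * poly (pderiv (hermite k)) t
     = - real k * poly (hermite k) t"
proof -
  have "poly (pderiv (hermite (Suc k))) t = real (Suc k) * poly (hermite k) t"
    by (simp only: pderiv_hermite_Suc poly_smult)
  then show ?thesis
    by (simp add: pderiv_diff pderiv_mult pderiv_pCons algebra_simps)
qed

lemma hermite_rec:
  "t * poly (hermite k) t = poly (hermite (Suc k)) t + real k * poly (hermite (k - 1)) t"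
proof (cases k)
  case 0
  then show ?thesis by simp
next
  case (Suc l)
  have "poly (pderiv (hermite k)) t = real k * poly (hermite l) t"
    unfolding Suc pderiv_hermite_Suc by simp
  then show ?thesis using Suc by simp
qed

lemma real_poly_lin:
  "real_polynomial_function f \<Longrightarrow> real_polynomial_function g \<Longrightarrow>
     real_polynomial_function (\<lambda>x. c * f x + g x)"
  by (intro real_polynomial_function.intros(2-))

lemma real_poly_has_partial:
  assumes "real_polynomial_function (f :: real ^ 'n \<Rightarrow> real)"
  shows "\<exists>g. real_polynomial_function g \<and>
    (\<forall>x. ((\<lambda>t. f (x + t *\<^sub>R axis j 1)) has_field_derivative g x) (at 0))"
  using assms
proof induction
  case (linear f)
  interpret bounded_linear f by fact
  show ?case
    by (intro exI[of _ "\<lambda>_. f (axis j 1)"])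
      (auto simp: add scaleR intro!: derivative_eq_intros)
next
  case (const c)
  show ?case by (intro exI[of _ "\<lambda>_. 0"]) auto
next
  case (add f g)
  then obtain f' g' where *: "real_polynomial_function f'" "real_polynomial_function g'"
    "\<And>x. ((\<lambda>t. f (x + t *\<^sub>R axis j 1)) has_field_derivative f' x) (at 0)"
    "\<And>x. ((\<lambda>t. g (x + t *\<^sub>R axis j 1)) has_field_derivative g' x) (at 0)" by blast
  show ?case
    by (intro exI[of _ "\<lambda>x. f' x + g' x"]) (auto intro!: * DERIV_add)
next
  case (mult f g)
  then obtain f' g' where *: "real_polynomial_function f'" "real_polynomial_function g'"
    "\<And>x. ((\<lambda>t. f (x + t *\<^sub>R axis j 1)) has_field_derivative f' x) (at 0)"
    "\<And>x. ((\<lambda>t. g (x + t *\<^sub>R axis j 1)) has_field_derivative g' x) (at 0)" by blast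
  have "((\<lambda>t. f (x + t *\<^sub>R axis j 1) * g (x + t *\<^sub>R axis j 1)) has_field_derivative
      f' x * g x + g' x * f x) (at 0)" for x
    using DERIV_mult[OF *(3)[of x] *(4)[of x]] by simp
  moreover have "real_polynomial_function (\<lambda>x. f' x * g x + g' x * f x)"
    using * mult by auto
  ultimately show ?case by (intro exI[of _ "\<lambda>x. f' x * g x + g' x * f x"]) auto
qed

lemma
  assumes "real_polynomial_function f"
  shows partial_deriv_works: "((\<lambda>t. f (x + t *\<^sub>R axis j 1)) has_field_derivative partial_deriv j f x) (at 0)"
    and real_poly_partial_deriv: "real_polynomial_function (partial_deriv j f)"
proof -
  obtain g where g: "real_polynomial_function g"
    "\<And>x. ((\<lambda>t. f (x + t *\<^sub>R axis j 1)) has_field_derivative g x) (at 0)"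
    using real_poly_has_partial[OF assms] by blast
  then have "partial_deriv j f = g" by (auto simp: partial_deriv_def fun_eq_iff intro!: DERIV_imp_deriv)
  with g show "((\<lambda>t. f (x + t *\<^sub>R axis j 1)) has_field_derivative partial_deriv j f x) (at 0)"
    "real_polynomial_function (partial_deriv j f)" by auto
qed

lemma partial_deriv_lin:
  assumes "real_polynomial_function f" "real_polynomial_function g"
  shows "partial_deriv j (\<lambda>x. c * f x + g x) = (\<lambda>x. c * partial_deriv j f x + partial_deriv j g x)"
  by (auto simp: fun_eq_iff partial_deriv_def[of _ "\<lambda>x. c * f x + g x"]
      intro!: DERIV_imp_deriv DERIV_add DERIV_cmult partial_deriv_works assms)

lemma OU_lin:
  assumes "real_polynomial_function f" "real_polynomial_function g"
  shows "OU (\<lambda>x. c * f x + g x) x = c * OU f x + OU g x"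
  unfolding OU_def laplacian_def grad_def
  by (simp add: partial_deriv_lin[OF assms] partial_deriv_lin[OF assms[THEN real_poly_partial_deriv]]
      inner_vec_def sum.distrib sum_distrib_left ring_distribs mult.left_commute)

lemma OU_zero: "OU (\<lambda>x. 0) x = 0"
  by (simp add: OU_def laplacian_def grad_def partial_deriv_def inner_vec_def)

lemma OU_ker_lin:
  assumes "f \<in> OU_ker k" "g \<in> OU_ker k"
  shows "(\<lambda>x. c * f x + g x) \<in> OU_ker k"
proof -
  have f: "real_polynomial_function f" "OU f x = - (real k * f x)" for x
    using assms(1) unfolding OU_ker_def by (auto simp: eq_neg_iff_add_eq_0)
  have g: "real_polynomial_function g" "OU g x = - (real k * g x)" for x
    using assms(2) unfolding OU_ker_def by (auto simp: eq_neg_iff_add_eq_0)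
  have "real_polynomial_function (\<lambda>x. c * f x + g x)" using f(1) g(1) by (rule real_poly_lin)
  then show ?thesis
    unfolding OU_ker_def using OU_lin[OF f(1) g(1)] by (simp add: f(2) g(2) ring_distribs mult.left_commute)
qed

lemma OU_ker_zero: "(\<lambda>x. 0) \<in> OU_ker k"
  by (auto simp: OU_ker_def OU_zero)

lemma OU_ker_cmult: "f \<in> OU_ker k \<Longrightarrow> (\<lambda>x. c * f x) \<in> OU_ker k"
  using OU_ker_lin[OF _ OU_ker_zero, of f k c] by simp

lemma OU_ker_sum:
  "finite A \<Longrightarrow> (\<And>i. i \<in> A \<Longrightarrow> f i \<in> OU_ker k) \<Longrightarrow> (\<lambda>x. \<Sum>i\<in>A. c i * f i x) \<in> OU_ker k"
  by (induction A rule: finite_induct) (auto intro: OU_ker_zero OU_ker_lin)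

lemma OU_sum:
  "finite A \<Longrightarrow> (\<And>i. i \<in> A \<Longrightarrow> real_polynomial_function (f i)) \<Longrightarrow>
     OU (\<lambda>x. \<Sum>i\<in>A. f i x) x = (\<Sum>i\<in>A. OU (f i) x)"
proof (induction A rule: finite_induct)
  case empty
  show ?case by (simp add: OU_zero)
next
  case (insert a A)
  have "real_polynomial_function (\<lambda>x. \<Sum>i\<in>A. f i x)" using insert by auto
  with OU_lin[of "f a" "\<lambda>x. \<Sum>i\<in>A. f i x" 1] insert show ?case by simp
qed

lemma real_poly_coord: "real_polynomial_function (\<lambda>x :: real ^ 'n. x $ j)"
  by (rule real_polynomial_function.intros(1)) (rule bounded_linear_vec_nth)

lemma real_poly_poly: "real_polynomial_function (\<lambda>x :: real ^ 'n. poly p (x $ j))"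
  by (induction p) (auto intro!: real_poly_coord)

lemma partial_deriv_prod_poly:
  fixes p :: "'n::finite \<Rightarrow> real poly"
  shows "partial_deriv j (\<lambda>x. \<Prod>l\<in>UNIV. poly (p l) (x $ l))
    = (\<lambda>x. \<Prod>l\<in>UNIV. poly ((p(j := pderiv (p j))) l) (x $ l))"
proof
  fix x :: "real ^ 'n"
  have *: "(\<Prod>l\<in>UNIV. h l) = h j * (\<Prod>l\<in>UNIV - {j}. h l)" for h :: "'n \<Rightarrow> real"
    by (simp add: prod.remove[of UNIV j])
  have "(\<lambda>t. \<Prod>l\<in>UNIV. poly (p l) ((x + t *\<^sub>R axis j 1) $ l))
     = (\<lambda>t. poly (p j) (x $ j + t) * (\<Prod>l\<in>UNIV - {j}. poly (p l) (x $ l)))"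
    by (subst *) (auto simp: axis_def intro!: prod.cong)
  moreover have "((\<lambda>t. poly (p j) (x $ j + t) * (\<Prod>l\<in>UNIV - {j}. poly (p l) (x $ l)))
      has_field_derivative poly (pderiv (p j)) (x $ j) * (\<Prod>l\<in>UNIV - {j}. poly (p l) (x $ l))) (at 0)"
    by (auto intro!: derivative_eq_intros DERIV_cmult_right)
  ultimately show "partial_deriv j (\<lambda>x. \<Prod>l\<in>UNIV. poly (p l) (x $ l)) x
    = (\<Prod>l\<in>UNIV. poly ((p(j := pderiv (p j))) l) (x $ l))"
    unfolding partial_deriv_def by (subst *) (auto intro!: DERIV_imp_deriv)
qed

lemma hermite_prod_split:
  "hermite_prod i x = poly (hermite (i j)) (x $ j) * (\<Prod>l\<in>UNIV - {j}. poly (hermite (i l)) (x $ l))"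
  by (simp add: hermite_prod_def prod.remove[of UNIV j])

lemma hermite_prod_in_ker:
  fixes i :: "'n::finite \<Rightarrow> nat"
  shows "hermite_prod i \<in> OU_ker (\<Sum>j\<in>UNIV. i j)"
proof -
  let ?R = "\<lambda>(x :: real ^ 'n) j. \<Prod>l\<in>UNIV - {j}. poly (hermite (i l)) (x $ l)"
  have *: "(\<Prod>l\<in>UNIV. h l) = h j * (\<Prod>l\<in>UNIV - {j}. h l)" for h :: "'n \<Rightarrow> real" and j
    by (simp add: prod.remove[of UNIV j])
  have "hermite_prod i = (\<lambda>x. \<Prod>j\<in>UNIV. poly ((\<lambda>j. hermite (i j)) j) (x $ j))"
    by (simp add: hermite_prod_def fun_eq_iff)
  note d1 = arg_cong[OF this, of "partial_deriv j" for j, unfolded partial_deriv_prod_poly]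
  have pd1: "partial_deriv j (hermite_prod i) x = poly (pderiv (hermite (i j))) (x $ j) * ?R x j" for j x
    unfolding d1 by (subst *[of _ j]) (auto intro!: prod.cong)
  have pd2: "partial_deriv j (partial_deriv j (hermite_prod i)) x
      = poly (pderiv (pderiv (hermite (i j)))) (x $ j) * ?R x j" for j x
    unfolding d1 partial_deriv_prod_poly by (subst *[of _ j]) (auto intro!: prod.cong)
  have "OU (hermite_prod i) x + real (\<Sum>j\<in>UNIV. i j) * hermite_prod i x = 0" for x
  proof -
    have "OU (hermite_prod i) x = (\<Sum>j\<in>UNIV. (poly (pderiv (pderiv (hermite (i j)))) (x $ j)
        - x $ j * poly (pderiv (hermite (i j))) (x $ j)) * ?R x j)"
      by (simp add: OU_def laplacian_def grad_def inner_vec_def pd1 pd2 sum_subtractf algebra_simps)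
    also have "\<dots> = (\<Sum>j\<in>UNIV. - real (i j) * hermite_prod i x)"
      unfolding hermite_ode by (intro sum.cong refl) (simp add: hermite_prod_split[symmetric])
    finally show ?thesis by (simp add: sum_distrib_right sum_negf)
  qed
  moreover have "real_polynomial_function (hermite_prod i)"
    unfolding hermite_prod_def by (auto intro!: real_poly_poly)
  ultimately show ?thesis by (simp add: OU_ker_def)
qed

lemma finite_multi_indices: "finite {i :: 'n::finite \<Rightarrow> nat. (\<Sum>j\<in>UNIV. i j) = k}"
proof (rule finite_subset)
  show "{i :: 'n \<Rightarrow> nat. (\<Sum>j\<in>UNIV. i j) = k} \<subseteq> UNIV \<rightarrow>\<^sub>E {..k}"
    by (auto simp: PiE_def intro: member_le_sum)
qed (auto intro: finite_PiE)

lemma wiener_chaos_subset_OU_ker: "wiener_chaos k \<subseteq> OU_ker k"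
proof
  fix F :: "real ^ 'n \<Rightarrow> real"
  assume "F \<in> wiener_chaos k"
  then obtain \<alpha> where F: "F = (\<lambda>x. \<Sum>i | (\<Sum>j\<in>UNIV. i j) = k. \<alpha> i * hermite_prod i x)"
    by (auto simp: wiener_chaos_def)
  show "F \<in> OU_ker k"
    unfolding F by (rule OU_ker_sum[OF finite_multi_indices]) (use hermite_prod_in_ker in auto)
qed

lemma wiener_chaos_zero: "(\<lambda>x. 0) \<in> wiener_chaos k"
  unfolding wiener_chaos_def by (auto intro!: exI[of _ "\<lambda>_. 0"])

lemma wiener_chaos_add_hermite:
  assumes "F \<in> wiener_chaos (\<Sum>j\<in>UNIV. i j)"
  shows "(\<lambda>x. c * hermite_prod i x + F x) \<in> wiener_chaos (\<Sum>j\<in>UNIV. i j)"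
proof -
  let ?A = "{i'. (\<Sum>j\<in>UNIV. i' j) = (\<Sum>j\<in>UNIV. i j)}"
  obtain \<alpha> where F: "F = (\<lambda>x. \<Sum>i'\<in>?A. \<alpha> i' * hermite_prod i' x)"
    using assms by (auto simp: wiener_chaos_def)
  have split: "(\<Sum>i'\<in>?A. h i') = h i + (\<Sum>i'\<in>?A - {i}. h i')" for h :: "_ \<Rightarrow> real"
    by (rule sum.remove) (auto intro: finite_multi_indices)
  have rest: "(\<Sum>i'\<in>?A - {i}. (\<alpha>(i := \<alpha> i + c)) i' * hermite_prod i' x)
      = (\<Sum>i'\<in>?A - {i}. \<alpha> i' * hermite_prod i' x)" for x
    by (rule sum.cong) (simp_all only: fun_upd_apply DiffD2 singleton_iff if_False Diff_iff simp_thms)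
  have "(\<lambda>x. c * hermite_prod i x + F x)
      = (\<lambda>x. \<Sum>i'\<in>?A. (\<alpha>(i := \<alpha> i + c)) i' * hermite_prod i' x)"
    unfolding F split rest by (simp only: fun_upd_same distrib_right add.assoc add.left_commute)
  then show ?thesis unfolding wiener_chaos_def by blast
qed

inductive_set hermite_span :: "(real ^ 'n \<Rightarrow> real) set" where
  zero: "(\<lambda>x. 0) \<in> hermite_span"
| step: "F \<in> hermite_span \<Longrightarrow> (\<lambda>x. c * hermite_prod i x + F x) \<in> hermite_span"

lemma hermite_span_add: "F \<in> hermite_span \<Longrightarrow> G \<in> hermite_span \<Longrightarrow> (\<lambda>x. F x + G x) \<in> hermite_span"
  by (induction rule: hermite_span.induct) (auto simp: add.assoc intro: hermite_span.intros)

lemma hermite_span_cmult: "F \<in> hermite_span \<Longrightarrow> (\<lambda>x. a * F x) \<in> hermite_span"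
proof (induction rule: hermite_span.induct)
  case (step F c i)
  from hermite_span.step[OF step.IH, of "a * c" i] show ?case
    by (simp add: algebra_simps)
qed (auto intro: hermite_span.intros)

lemma hermite_span_coord: "F \<in> hermite_span \<Longrightarrow> (\<lambda>x. x $ j * F x) \<in> hermite_span"
proof (induction rule: hermite_span.induct)
  case (step F c i)
  have "x $ j * hermite_prod i x
      = hermite_prod (i(j := Suc (i j))) x + real (i j) * hermite_prod (i(j := i j - 1)) x" for x
    unfolding hermite_prod_split[of _ x j] mult.assoc[symmetric] hermite_rec
    by (simp add: algebra_simps)
  then have "(\<lambda>x. x $ j * (c * hermite_prod i x + F x))
      = (\<lambda>x. c * hermite_prod (i(j := Suc (i j))) x
          + (c * real (i j) * hermite_prod (i(j := i j - 1)) x + x $ j * F x))"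
    by (auto simp: fun_eq_iff algebra_simps)
  then show ?case using step.IH by (auto intro!: hermite_span.step)
qed (auto intro: hermite_span.intros)

lemma hermite_span_sum:
  "finite A \<Longrightarrow> (\<And>j. j \<in> A \<Longrightarrow> F j \<in> hermite_span) \<Longrightarrow> (\<lambda>x. \<Sum>j\<in>A. F j x) \<in> hermite_span"
  by (induction A rule: finite_induct) (auto intro: hermite_span.zero hermite_span_add)

lemma hermite_span_poly_mult:
  assumes "real_polynomial_function (p :: real ^ 'n \<Rightarrow> real)" "F \<in> hermite_span"
  shows "(\<lambda>x. p x * F x) \<in> hermite_span"
  using assms
proof (induction p arbitrary: F)
  case (linear f)
  interpret bounded_linear f by fact
  have f: "f x = (\<Sum>j\<in>UNIV. f (axis j 1) * x $ j)" for x
    using arg_cong[OF basis_expansion[of x], of f]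
    by (simp add: sum scaleR mult.commute scalar_mult_eq_scaleR)
  have "(\<lambda>x. f x * F x) = (\<lambda>x. \<Sum>j\<in>UNIV. f (axis j 1) * (x $ j * F x))"
    by (rule ext, subst f) (simp only: sum_distrib_right mult.assoc)
  then show ?case
    using linear.prems by (simp only:) (intro hermite_span_sum hermite_span_cmult hermite_span_coord finite)
next
  case (add f g)
  then show ?case by (auto simp: ring_distribs intro!: hermite_span_add)
next
  case (mult f g)
  then show ?case by (auto simp: mult.assoc)
qed (auto intro: hermite_span_cmult)

lemma hermite_span_polys:
  assumes "real_polynomial_function (p :: real ^ 'n \<Rightarrow> real)"
  shows "p \<in> hermite_span"
proof -
  have "(\<lambda>x. 1 * hermite_prod (\<lambda>_. 0) x + 0) \<in> hermite_span"
    by (intro hermite_span.intros)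
  then have "(\<lambda>x :: real ^ 'n. 1) \<in> hermite_span" by (simp add: hermite_prod_def)
  from hermite_span_poly_mult[OF assms this] show ?thesis by simp
qed

lemma hermite_span_decomp:
  assumes "F \<in> hermite_span"
  shows "\<exists>N0. \<forall>N\<ge>N0. \<exists>C. (\<forall>k. C k \<in> wiener_chaos k) \<and> (\<forall>x. F x = (\<Sum>k<N. C k x))"
  using assms
proof (induction rule: hermite_span.induct)
  case zero
  have "\<exists>C :: nat \<Rightarrow> real ^ 'a \<Rightarrow> real.
      (\<forall>k. C k \<in> wiener_chaos k) \<and> (\<forall>x. 0 = (\<Sum>k<N. C k x))" for N :: nat
    by (rule exI[where x = "\<lambda>k x. 0"]) (simp add: wiener_chaos_zero)
  then show ?case by simp
next
  case (step F c i)
  from step.IH obtain N0 where N0: "\<forall>N\<ge>N0.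
    \<exists>C. (\<forall>k. C k \<in> wiener_chaos k) \<and> (\<forall>x. F x = (\<Sum>k<N. C k x))" ..
  define s where "s = (\<Sum>j\<in>UNIV. i j)"
  show ?case
  proof (rule exI[where x = "max N0 (Suc s)"], rule allI, rule impI)
    fix N assume N: "max N0 (Suc s) \<le> N"
    then have "N0 \<le> N" "s < N" by simp_all
    from N0[rule_format, OF \<open>N0 \<le> N\<close>] obtain C
      where C: "\<forall>k. C k \<in> wiener_chaos k" "\<forall>x. F x = (\<Sum>k<N. C k x)"
      by (elim exE conjE)
    define D where "D = (\<lambda>x. c * hermite_prod i x + C s x)"
    have "D \<in> wiener_chaos s"
      unfolding D_def s_def by (rule wiener_chaos_add_hermite) (rule C(1)[rule_format])
    then have "\<forall>k. (C(s := D)) k \<in> wiener_chaos k"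
      using C(1) by simp
    moreover have "\<forall>x. c * hermite_prod i x + F x = (\<Sum>k<N. (C(s := D)) k x)"
    proof
      fix x
      have *: "(\<Sum>k<N. h k) = h s + (\<Sum>k\<in>{..<N} - {s}. h k)" for h :: "nat \<Rightarrow> real"
        by (rule sum.remove) (use \<open>s < N\<close> in simp_all)
      have "(\<Sum>k\<in>{..<N} - {s}. (C(s := D)) k x) = (\<Sum>k\<in>{..<N} - {s}. C k x)"
        by (rule sum.cong) simp_all
      then show "c * hermite_prod i x + F x = (\<Sum>k<N. (C(s := D)) k x)"
        unfolding C(2)[rule_format, of x] * by (simp add: D_def)
    qed
    ultimately show "\<exists>C. (\<forall>k. C k \<in> wiener_chaos k) \<and>
      (\<forall>x. c * hermite_prod i x + F x = (\<Sum>k<N. C k x))"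
      by (intro exI[where x = "C(s := D)"] conjI)
  qed
qed

lemma OU_ker_independent:
  assumes "\<And>l. l < N \<Longrightarrow> C l \<in> OU_ker l" "\<And>x. (\<Sum>l<N. C l x) = 0" "l < N"
  shows "C l x = 0"
  using assms
proof (induction N arbitrary: C l x)
  case (Suc N)
  have C: "real_polynomial_function (C l)" "OU (C l) x = - (real l * C l x)" if "l \<le> N" for l x
    using Suc.prems(1)[of l] that unfolding OU_ker_def by (auto simp: eq_neg_iff_add_eq_0)
  have "(\<Sum>l<N. (real N - real l) * C l x) = 0" for x
  proof -
    have "0 = OU (\<lambda>x. \<Sum>l<Suc N. C l x) x" unfolding Suc.prems(2) OU_zero ..
    also have "\<dots> = (\<Sum>l<Suc N. OU (C l) x)"
      by (rule OU_sum) (auto intro: C)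
    also have "\<dots> = (\<Sum>l<Suc N. - real l * C l x)"
      by (rule sum.cong) (auto simp: C)
    finally have "(\<Sum>l<Suc N. - real l * C l x) + real N * (\<Sum>l<Suc N. C l x) = 0"
      unfolding Suc.prems(2) by simp
    then show ?thesis
      by (simp add: sum_distrib_left algebra_simps sum_subtractf sum_negf)
  qed
  then have "(real N - real l) * C l x = 0" if "l < N" for l x
    using that by (intro Suc.IH[of "\<lambda>l x. (real N - real l) * C l x"])
      (auto intro!: OU_ker_cmult Suc.prems(1))
  then have 0: "C l x = 0" if "l < N" for l x using that by force
  with Suc.prems(2)[of x] have "C N x = 0" by simp
  with 0 Suc.prems(3) show ?case by (cases "l = N") auto
qed simp

theorem OU_ker_eq_wiener_chaos: "OU_ker k = wiener_chaos k"
proof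
  show "OU_ker k \<subseteq> (wiener_chaos k :: (real ^ 'n \<Rightarrow> real) set)"
  proof
    fix F :: "real ^ 'n \<Rightarrow> real"
    assume F: "F \<in> OU_ker k"
    then have "F \<in> hermite_span" by (intro hermite_span_polys) (auto simp: OU_ker_def)
    from hermite_span_decomp[OF this] obtain N0 where
      "\<forall>N\<ge>N0. \<exists>C. (\<forall>l. C l \<in> wiener_chaos l) \<and> (\<forall>x. F x = (\<Sum>l<N. C l x))" ..
    then have "\<exists>C. (\<forall>l. C l \<in> wiener_chaos l) \<and> (\<forall>x. F x = (\<Sum>l<max N0 (Suc k). C l x))"
      by (rule allE[where x = "max N0 (Suc k)"]) simp
    then obtain C where C: "\<forall>l. C l \<in> wiener_chaos l" "\<forall>x. F x = (\<Sum>l<max N0 (Suc k). C l x)"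
      by (elim exE conjE)
    define N where "N = max N0 (Suc k)"
    have N: "k < N" by (simp add: N_def)
    define D where "D = (\<lambda>x. - 1 * F x + C k x)"
    have C_ker: "C l \<in> OU_ker l" for l
      using C(1) wiener_chaos_subset_OU_ker by blast
    have "D \<in> OU_ker k"
      unfolding D_def by (rule OU_ker_lin[OF F C_ker])
    have "(C(k := D)) k x = 0" for x
    proof (rule OU_ker_independent[of N "C(k := D)" k, OF _ _ N])
      show "(C(k := D)) l \<in> OU_ker l" for l
        using C_ker \<open>D \<in> OU_ker k\<close> by simp
      fix x
      have *: "(\<Sum>l<N. h l) = h k + (\<Sum>l\<in>{..<N} - {k}. h l)" for h :: "nat \<Rightarrow> real"
        by (rule sum.remove) (use N in simp_all)
      have "(\<Sum>l\<in>{..<N} - {k}. (C(k := D)) l x) = (\<Sum>l\<in>{..<N} - {k}. C l x)"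
        by (rule sum.cong) simp_all
      moreover have "F x = C k x + (\<Sum>l\<in>{..<N} - {k}. C l x)"
        using C(2)[rule_format, of x] *[of "\<lambda>l. C l x"] by (simp add: N_def)
      ultimately show "(\<Sum>l<N. (C(k := D)) l x) = 0"
        unfolding * by (simp add: D_def)
    qed
    then have "F = C k" by (simp add: fun_eq_iff D_def)
    then show "F \<in> wiener_chaos k" using C(1) by simp
  qed
qed (rule wiener_chaos_subset_OU_ker)

end

theory Submission
  imports Defs
begin

text \<open>
  Write \<open>E\<close> for the standard Gaussian expectation, \<open>\<L>\<close> for the Ornstein-Uhlenbeck operator and
  \<open>\<Gamma>(f, g) = \<langle>\<nabla>f, \<nabla>g\<rangle>\<close>.  Everything rests on one fact about a \<open>k\<close>-th chaos element \<open>F\<close> and an \<open>l\<close>-th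
  chaos element \<open>G\<close>: the covariance of \<open>F\<^sup>2\<close> and \<open>G\<^sup>2\<close> is nonnegative, and it vanishes only if
  \<open>\<nabla>F(x)\<close> is orthogonal to \<open>\<nabla>G(y)\<close> for \<^emph>\<open>all\<close> points \<open>x\<close> and \<open>y\<close>
  (\<open>squares_cov_nonneg\<close>, \<open>squares_cov_zero\<close>).

  Given that fact, let \<open>P\<^sub>i\<close> be the sum of the squares of \<open>F\<^sub>i\<^sub>k\<close>.  The covariance of \<open>P\<^sub>i\<close> and \<open>P\<^sub>j\<close> is a sum of
  nonnegative covariances and is zero by independence, so every summand is zero.  Hence
  the spaces \<open>V\<^sub>i\<close> spanned by all gradients of all \<open>F\<^sub>i\<^sub>k\<close> are pairwise orthogonal.  A polynomial whose
  gradients lie in \<open>V\<^sub>i\<close> depends only on the projection of its argument to \<open>V\<^sub>i\<close>; the coordinates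
  with respect to an orthonormal basis that contains orthonormal bases of all \<open>V\<^sub>i\<close> are the
  required \<open>Y\<^sub>j\<close>.

  The fact about \<open>F\<close> and \<open>G\<close> is proved by letting one independent copy rotate into the other.  Put
  \<open>\<phi>(t) = E[F(x)\<^sup>2 G(x cos t + y sin t)\<^sup>2]\<close> for independent standard Gaussian vectors \<open>x\<close> and \<open>y\<close>, so
  that \<open>\<phi>(0) = E[F\<^sup>2 G\<^sup>2]\<close> and \<open>\<phi>(\<pi>/2) = E[F\<^sup>2] E[G\<^sup>2]\<close>.  Gaussian integration by parts shows that, for
  \<open>0 < t < \<pi>/2\<close>, \<open>\<phi>'(t)\<close> is a nonpositive multiple of \<open>E[H \<Gamma>(F, G\<^sub>t)]\<close>, where
  \<open>G\<^sub>t(x, y) = G(x cos t + y sin t)\<close> lies in the \<open>l\<close>-th chaos on the doubled space and \<open>H = F G\<^sub>t\<close> (\<open>rotation_derivative\<close>, \<open>eigen_mix\<close>).  Now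
  \<open>\<L>H = - (k + l) H + 2 \<Gamma>(F, G\<^sub>t)\<close> and therefore
  \<open>2 E[H \<Gamma>(F, G\<^sub>t)] = (k + l) E[H\<^sup>2] - E[\<Gamma>(H, H)]\<close>.
  The right-hand side is nonnegative because \<open>H\<close> has degree at most \<open>k + l\<close>: polynomials of degree
  at most \<open>d\<close> satisfy \<open>E[\<Gamma>(H, H)] \<le> d E[H\<^sup>2]\<close>, with equality only if \<open>\<L>H = - d H\<close>
  (\<open>reverse_poincare\<close>).  So \<open>\<phi>\<close> decreases.  If the covariance is zero, then \<open>\<phi>\<close> is constant, the
  equality case applies at \<open>t = \<pi>/4\<close> and gives \<open>\<Gamma>(F, G\<^sub>t) = 0\<close> everywhere.  At this angle \<open>x\<close> and
  \<open>x cos t + y sin t\<close> can be prescribed independently of each other, which is the claim.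

  Gaussian expectation and \<open>\<L>\<close> are developed for polynomials on an arbitrary Euclidean space,
  since the rotation argument needs them on \<open>\<real>\<^sup>n \<times> \<real>\<^sup>n\<close> as well as on \<open>\<real>\<^sup>n\<close>.
\<close>

section \<open>Directional derivatives of polynomials\<close>

abbreviation rpoly :: "('a::real_normed_vector \<Rightarrow> real) \<Rightarrow> bool" where
  "rpoly \<equiv> real_polynomial_function"

text \<open>
  The value along \<open>v\<close> of the Frechet derivative is linear in \<open>v\<close>, so derivatives along
  basis vectors determine all others, and the chain rule for linear substitutions is immediate.
\<close>

definition dir_deriv :: "'a::real_normed_vector \<Rightarrow> ('a \<Rightarrow> real) \<Rightarrow> 'a \<Rightarrow> real" where
  "dir_deriv v f x = frechet_derivative f (at x) v"

lemma rpoly_differentiable: "rpoly f \<Longrightarrow> f differentiable at x"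
proof (induction rule: real_polynomial_function.induct)
  case (linear f)
  then show ?case by (rule bounded_linear_imp_differentiable)
qed auto

lemma dir_deriv_has_derivative:
  "rpoly f \<Longrightarrow> (f has_derivative (\<lambda>v. dir_deriv v f x)) (at x)"
  using rpoly_differentiable[of f x] by (simp add: dir_deriv_def frechet_derivative_works)

lemma dir_deriv_eqI: "(f has_derivative f') (at x) \<Longrightarrow> dir_deriv v f x = f' v"
  by (metis dir_deriv_def frechet_derivative_at)

lemma linear_dir_deriv: "rpoly f \<Longrightarrow> linear (\<lambda>v. dir_deriv v f x)"
  using dir_deriv_has_derivative has_derivative_linear by blast

lemma dir_deriv_scale: "rpoly f \<Longrightarrow> dir_deriv (c *\<^sub>R v) f x = c * dir_deriv v f x"
  using linear_cmul[OF linear_dir_deriv] by fastforce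

lemma dir_deriv_zero: "rpoly f \<Longrightarrow> dir_deriv 0 f x = 0"
  using linear_0[OF linear_dir_deriv] by fastforce

lemma dir_deriv_expand:
  fixes v :: "'a::euclidean_space"
  assumes "rpoly f"
  shows "dir_deriv v f x = (\<Sum>b\<in>Basis. (v \<bullet> b) * dir_deriv b f x)"
proof -
  interpret linear "\<lambda>v. dir_deriv v f x" by (rule linear_dir_deriv[OF assms])
  have "dir_deriv (\<Sum>b\<in>Basis. (v \<bullet> b) *\<^sub>R b) f x = (\<Sum>b\<in>Basis. (v \<bullet> b) * dir_deriv b f x)"
    by (simp only: sum scale real_scaleR_def)
  then show ?thesis by (simp add: euclidean_representation)
qed

lemma dir_deriv_bounded_linear: "bounded_linear f \<Longrightarrow> dir_deriv v f = (\<lambda>_. f v)"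
  by (auto simp: fun_eq_iff intro!: dir_deriv_eqI bounded_linear_imp_has_derivative)

lemma dir_deriv_const: "dir_deriv v (\<lambda>_. c) = (\<lambda>_. 0)"
  by (auto simp: fun_eq_iff intro!: dir_deriv_eqI[where f' = "\<lambda>_. 0"])

lemma dir_deriv_add:
  "rpoly f \<Longrightarrow> rpoly g \<Longrightarrow> dir_deriv v (\<lambda>x. f x + g x) = (\<lambda>x. dir_deriv v f x + dir_deriv v g x)"
  by (rule ext, rule dir_deriv_eqI[where f' = "\<lambda>v. dir_deriv v f x + dir_deriv v g x" for x])
    (intro has_derivative_add dir_deriv_has_derivative)

lemma dir_deriv_mult:
  "rpoly f \<Longrightarrow> rpoly g \<Longrightarrow>
     dir_deriv v (\<lambda>x. f x * g x) = (\<lambda>x. f x * dir_deriv v g x + dir_deriv v f x * g x)"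
  by (rule ext, rule dir_deriv_eqI[where f' = "\<lambda>v. f x * dir_deriv v g x + dir_deriv v f x * g x" for x])
    (intro has_derivative_mult dir_deriv_has_derivative)

lemma dir_deriv_cmult: "rpoly f \<Longrightarrow> dir_deriv v (\<lambda>x. c * f x) = (\<lambda>x. c * dir_deriv v f x)"
  by (subst dir_deriv_mult) (auto simp: dir_deriv_const)

lemma dir_deriv_diff:
  "rpoly f \<Longrightarrow> rpoly g \<Longrightarrow> dir_deriv v (\<lambda>x. f x - g x) = (\<lambda>x. dir_deriv v f x - dir_deriv v g x)"
  by (rule ext, rule dir_deriv_eqI[where f' = "\<lambda>v. dir_deriv v f x - dir_deriv v g x" for x])
    (intro has_derivative_diff dir_deriv_has_derivative)

lemma dir_deriv_sum:
  "finite I \<Longrightarrow> (\<And>i. i \<in> I \<Longrightarrow> rpoly (f i)) \<Longrightarrow>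
     dir_deriv v (\<lambda>x. \<Sum>i\<in>I. f i x) = (\<lambda>x. \<Sum>i\<in>I. dir_deriv v (f i) x)"
  by (rule ext, rule dir_deriv_eqI[where f' = "\<lambda>v. \<Sum>i\<in>I. dir_deriv v (f i) x" for x])
    (intro has_derivative_sum dir_deriv_has_derivative)

lemma dir_deriv_compose_linear:
  assumes "rpoly f" "bounded_linear A"
  shows "dir_deriv v (\<lambda>x. f (A x)) = (\<lambda>x. dir_deriv (A v) f (A x))"
  by (rule ext, rule dir_deriv_eqI[where f' = "\<lambda>v. dir_deriv (A v) f (A x)" for x])
    (rule has_derivative_compose[OF bounded_linear_imp_has_derivative[OF assms(2)]
        dir_deriv_has_derivative[OF assms(1)]])

lemma rpoly_compose_linear: "rpoly f \<Longrightarrow> bounded_linear A \<Longrightarrow> rpoly (\<lambda>x. f (A x))"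
  by (rule real_polynomial_function_compose[of A f, unfolded o_def])
    (auto intro: polynomial_function_bounded_linear)

lemma rpoly_dir_deriv: "rpoly f \<Longrightarrow> rpoly (dir_deriv v f)"
  by (induction rule: real_polynomial_function.induct)
    (auto simp: dir_deriv_bounded_linear dir_deriv_const dir_deriv_add dir_deriv_mult)

lemma dir_deriv_commute:
  "rpoly f \<Longrightarrow> dir_deriv v (dir_deriv w f) = dir_deriv w (dir_deriv v f)"
proof (induction rule: real_polynomial_function.induct)
  case (mult f g)
  then show ?case
    by (simp add: dir_deriv_mult dir_deriv_add rpoly_dir_deriv real_polynomial_function.intros(4) algebra_simps)
qed (auto simp: dir_deriv_bounded_linear dir_deriv_const dir_deriv_add rpoly_dir_deriv)

lemma continuous_on_rpoly: "rpoly f \<Longrightarrow> continuous_on S f"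
  by (simp add: continuous_at_imp_continuous_on differentiable_imp_continuous_within rpoly_differentiable)

lemma measurable_rpoly: "rpoly f \<Longrightarrow> f \<in> borel_measurable borel"
  by (intro borel_measurable_continuous_onI continuous_on_rpoly)

lemma rpoly_inner: "rpoly (\<lambda>x. x \<bullet> b)"
  by (intro real_polynomial_function.intros(1) bounded_linear_inner_left)

lemma rpoly_cmult: "rpoly f \<Longrightarrow> rpoly (\<lambda>x. c * f x)"
  by (intro real_polynomial_function.intros(4) real_polynomial_function.intros(2))

lemmas rpoly_intros = real_polynomial_function.intros(2) real_polynomial_function.intros(3)
  real_polynomial_function.intros(4) real_polynomial_function_diff real_polynomial_function_minus
  real_polynomial_function_power real_polynomial_function_sum
  rpoly_dir_deriv rpoly_inner finite_Basis

section \<open>Gaussian expectation of polynomials\<close>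

definition gauss_density :: "'a::euclidean_space \<Rightarrow> real" where
  "gauss_density x = (\<Prod>b\<in>Basis. std_normal_density (x \<bullet> b))"

definition gexp :: "('a::euclidean_space \<Rightarrow> real) \<Rightarrow> real" where
  "gexp p = (\<integral>x. gauss_density x * p x \<partial>lborel)"

definition gint :: "('a::euclidean_space \<Rightarrow> real) \<Rightarrow> bool" where
  "gint p \<longleftrightarrow> integrable lborel (\<lambda>x. gauss_density x * p x)"

definition moment :: "nat \<Rightarrow> real" where
  "moment k = (\<integral>t. std_normal_density t * t ^ k \<partial>lborel)"

text \<open>
  This is one-dimensional integration by parts, applied to \<open>t ^ k\<close>; it follows here from the
  explicit moments.
\<close>

lemma moment_rec: "moment (Suc k) = real k * moment (k - 1)"
proof (cases "even k")
  case True
  then obtain n where n: "k = 2 * n" by (auto elim: evenE)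
  have "moment (Suc (2 * n)) = 0" 
    using integral_std_normal_moment_odd[of n] by (simp add: moment_def)
  moreover have "moment (k - 1) = 0" if "k \<noteq> 0"
  proof -
    from that n obtain m where "n = Suc m" by (cases n) auto
    with n show ?thesis using integral_std_normal_moment_odd[of m] by (simp add: moment_def)
  qed
  ultimately show ?thesis using n by (cases "k = 0") auto
next
  case False
  then obtain n where n: "k = 2 * n + 1" by (auto elim: oddE)
  have m: "moment (2 * n) = fact (2 * n) / (2 ^ n * fact n)" for n
    unfolding moment_def by (rule integral_std_normal_moment_even)
  have e1: "fact (2 * Suc n) = (2 * real n + 2) * ((2 * real n + 1) * fact (2 * n))"
    by (simp add: algebra_simps)
  have e2: "(2 ^ Suc n * fact (Suc n) :: real) = (2 * real n + 2) * (2 ^ n * fact n)"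
    by (simp add: algebra_simps)
  have nz: "2 * real n + 2 \<noteq> 0" by linarith
  have "moment (2 * Suc n) = (2 * real n + 1) * fact (2 * n) / (2 ^ n * fact n)"
    unfolding m[of "Suc n"] e1 e2 by (rule mult_divide_mult_cancel_left[OF nz])
  also have "\<dots> = (2 * real n + 1) * moment (2 * n)" unfolding m[of n] by simp
  finally show ?thesis using n by simp
qed

definition monomial :: "('a::euclidean_space \<Rightarrow> nat) \<Rightarrow> 'a \<Rightarrow> real" where
  "monomial i x = (\<Prod>b\<in>Basis. (x \<bullet> b) ^ i b)"

lemma
  fixes h :: "'a::euclidean_space \<Rightarrow> real \<Rightarrow> real"
  assumes h: "\<And>b. b \<in> Basis \<Longrightarrow> integrable lborel (h b)"
  shows integrable_lborel_prod: "integrable lborel (\<lambda>x. \<Prod>b\<in>Basis. h b (x \<bullet> b))"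
    and integral_lborel_prod:
      "(\<integral>x. (\<Prod>b\<in>Basis. h b (x \<bullet> b)) \<partial>lborel) = (\<Prod>b\<in>Basis. integral\<^sup>L lborel (h b))"
proof -
  interpret product_sigma_finite "\<lambda>_::'a. lborel :: real measure" by standard
  let ?T = "\<lambda>f. \<Sum>b\<in>Basis. f b *\<^sub>R b :: 'a"
  let ?N = "\<Pi>\<^sub>M b\<in>(Basis :: 'a set). (lborel :: real measure)"
  have hm [measurable]: "h b \<in> borel_measurable borel" if "b \<in> Basis" for b
    using borel_measurable_integrable[OF h[OF that]] by simp
  have [measurable]: "?T \<in> measurable ?N borel" by measurable
  have [measurable]: "(\<lambda>x. \<Prod>b\<in>Basis. h b (x \<bullet> b)) \<in> borel_measurable borel" by measurable
  have inner: "?T f \<bullet> b = f b" if "b \<in> Basis" for f b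
    using that by (simp add: inner_sum_left inner_Basis if_distrib sum.delta cong: if_cong)
  have eq: "(\<Prod>b\<in>Basis. h b (?T f \<bullet> b)) = (\<Prod>b\<in>Basis. h b (f b))" for f
    by (intro prod.cong refl) (simp add: inner del: inner_sum_left_Basis)
  show "integrable lborel (\<lambda>x. \<Prod>b\<in>Basis. h b (x \<bullet> b))"
    by (subst lborel_eq, subst integrable_distr_eq, measurable)
      (unfold eq, intro product_integrable_prod finite_Basis h)
  show "(\<integral>x. (\<Prod>b\<in>Basis. h b (x \<bullet> b)) \<partial>lborel) = (\<Prod>b\<in>Basis. integral\<^sup>L lborel (h b))"
    by (subst lborel_eq, subst integral_distr, measurable)
      (unfold eq, intro product_integral_prod finite_Basis h)
qed

lemma
  shows gint_monomial: "gint (monomial i)"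
    and gexp_monomial: "gexp (monomial i) = (\<Prod>b\<in>Basis. moment (i b))"
proof -
  have eq: "gauss_density x * monomial i x = (\<Prod>b\<in>Basis. std_normal_density (x \<bullet> b) * (x \<bullet> b) ^ i b)" for x :: 'a
    by (simp add: gauss_density_def monomial_def prod.distrib)
  show "gint (monomial i)"
    unfolding gint_def eq by (rule integrable_lborel_prod[of "\<lambda>b t. std_normal_density t * t ^ i b"])
      (rule integrable_std_normal_moment)
  show "gexp (monomial i) = (\<Prod>b\<in>Basis. moment (i b))"
    unfolding gexp_def eq moment_def
    by (rule integral_lborel_prod[of "\<lambda>b t. std_normal_density t * t ^ i b"])
      (rule integrable_std_normal_moment)
qed

lemma rpoly_monomial: "rpoly (monomial i)"
  unfolding monomial_def by (intro real_polynomial_function_prod rpoly_intros)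

lemma monomial_split:
  "b \<in> Basis \<Longrightarrow> monomial i x = (x \<bullet> b) ^ i b * (\<Prod>c\<in>Basis - {b}. (x \<bullet> c) ^ i c)"
  by (simp add: monomial_def prod.remove[of Basis b])

lemma mult_monomial:
  assumes "b \<in> Basis"
  shows "(x \<bullet> b) * monomial i x = monomial (i(b := Suc (i b))) x"
proof -
  have "(\<Prod>c\<in>Basis - {b}. (x \<bullet> c) ^ (i(b := Suc (i b))) c) = (\<Prod>c\<in>Basis - {b}. (x \<bullet> c) ^ i c)"
    by (rule prod.cong) auto
  then show ?thesis by (simp add: monomial_split[OF assms])
qed

lemma dir_deriv_monomial:
  fixes b :: "'a::euclidean_space"
  assumes b: "b \<in> Basis"
  shows "dir_deriv b (monomial i) = (\<lambda>x. real (i b) * monomial (i(b := i b - 1)) x)"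
proof
  fix x :: 'a
  let ?R = "\<lambda>x. \<Prod>c\<in>Basis - {b}. (x \<bullet> c) ^ i c"
  have pow: "rpoly (\<lambda>x. (x \<bullet> b) ^ n)" for n by (intro rpoly_intros)
  have R: "rpoly ?R" by (intro real_polynomial_function_prod rpoly_intros) auto
  have "dir_deriv b ?R x = (\<Sum>c\<in>Basis - {b}. (real (i c) * (b \<bullet> c) * (x \<bullet> c) ^ (i c - 1)) *
      (\<Prod>d\<in>Basis - {b} - {c}. (x \<bullet> d) ^ i d))"
    by (rule dir_deriv_eqI) (auto intro!: derivative_eq_intros simp: ac_simps)
  also have "\<dots> = 0"
    using b by (intro sum.neutral) (auto simp: inner_Basis)
  finally have R0: "dir_deriv b ?R x = 0" .
  have "dir_deriv b (\<lambda>x. (x \<bullet> b) ^ i b) x = real (i b) * (b \<bullet> b) * (x \<bullet> b) ^ (i b - 1)"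
    by (rule dir_deriv_eqI) (auto intro!: derivative_eq_intros)
  then have pow': "dir_deriv b (\<lambda>x. (x \<bullet> b) ^ i b) x = real (i b) * (x \<bullet> b) ^ (i b - 1)"
    using b by simp
  have split: "monomial i = (\<lambda>x. (x \<bullet> b) ^ i b * ?R x)" using monomial_split[OF b] by blast
  have "dir_deriv b (monomial i) x = real (i b) * (x \<bullet> b) ^ (i b - 1) * ?R x"
    unfolding split by (simp only: dir_deriv_mult[OF pow R] R0 pow' mult_zero_right add_0_left)
  also have "?R x = (\<Prod>c\<in>Basis - {b}. (x \<bullet> c) ^ (i(b := i b - 1)) c)"
    by (rule prod.cong) auto
  also have "real (i b) * (x \<bullet> b) ^ (i b - 1) * \<dots> = real (i b) * monomial (i(b := i b - 1)) x"
    by (simp add: monomial_split[OF b])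
  finally show "dir_deriv b (monomial i) x = real (i b) * monomial (i(b := i b - 1)) x" .
qed

lemma gexp_cmult: "gexp (\<lambda>x. c * f x) = c * gexp f"
  by (simp add: gexp_def mult.left_commute[of _ c])

text \<open>
  The Gaussian expectation of a monomial is a product of one-dimensional moments, and only the
  factor that belongs to \<open>b\<close> changes; the claim is the recursion for that factor.
\<close>

lemma gexp_monomial_by_parts:
  assumes b: "b \<in> Basis"
  shows "gexp (\<lambda>x. (x \<bullet> b) * monomial i x) = gexp (dir_deriv b (monomial i))"
proof -
  have split: "gexp (monomial j) = moment (j b) * (\<Prod>c\<in>Basis - {b}. moment (j c))" for j
    unfolding gexp_monomial using b by (simp add: prod.remove[of Basis b])
  have r: "(\<Prod>c\<in>Basis - {b}. moment ((i(b := n)) c)) = (\<Prod>c\<in>Basis - {b}. moment (i c))" for n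
    by (rule prod.cong) auto
  show ?thesis
    unfolding mult_monomial[OF b] dir_deriv_monomial[OF b] gexp_cmult split by (simp add: r moment_rec)
qed

text \<open>
  Integrability and integration by parts are linear in the polynomial, and every
  polynomial is a linear combination of monomials; so both need to be checked on monomials only.
\<close>

inductive_set monomial_span :: "('a::euclidean_space \<Rightarrow> real) set" where
  zero: "(\<lambda>x. 0) \<in> monomial_span"
| step: "F \<in> monomial_span \<Longrightarrow> (\<lambda>x. c * monomial i x + F x) \<in> monomial_span"

lemma monomial_span_add:
  "F \<in> monomial_span \<Longrightarrow> G \<in> monomial_span \<Longrightarrow> (\<lambda>x. F x + G x) \<in> monomial_span"
  by (induction rule: monomial_span.induct) (auto simp: add.assoc intro: monomial_span.intros)

lemma monomial_span_cmult: "F \<in> monomial_span \<Longrightarrow> (\<lambda>x. a * F x) \<in> monomial_span"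
proof (induction rule: monomial_span.induct)
  case (step F c i)
  from monomial_span.step[OF step.IH, of "a * c" i] show ?case
    by (simp add: algebra_simps)
qed (auto intro: monomial_span.intros)

lemma monomial_span_inner:
  "F \<in> monomial_span \<Longrightarrow> b \<in> Basis \<Longrightarrow> (\<lambda>x. (x \<bullet> b) * F x) \<in> monomial_span"
proof (induction rule: monomial_span.induct)
  case (step F c i)
  then show ?case
    using monomial_span.step[OF step.IH[OF step.prems], of c "i(b := Suc (i b))"]
    by (simp add: distrib_left mult.left_commute[of _ c] mult_monomial)
qed (auto intro: monomial_span.intros)

lemma monomial_span_sum:
  "finite A \<Longrightarrow> (\<And>j. j \<in> A \<Longrightarrow> F j \<in> monomial_span) \<Longrightarrow> (\<lambda>x. \<Sum>j\<in>A. F j x) \<in> monomial_span"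
  by (induction A rule: finite_induct) (auto intro: monomial_span.zero monomial_span_add)

lemma bounded_linear_expand:
  fixes f :: "'a::euclidean_space \<Rightarrow> real"
  assumes "bounded_linear f"
  shows "f x = (\<Sum>b\<in>Basis. f b * (x \<bullet> b))"
proof -
  interpret bounded_linear f by fact
  have "f (\<Sum>b\<in>Basis. (x \<bullet> b) *\<^sub>R b) = (\<Sum>b\<in>Basis. f b * (x \<bullet> b))"
    by (simp only: sum scaleR real_scaleR_def mult.commute)
  then show ?thesis by (simp add: euclidean_representation)
qed

lemma monomial_span_poly_mult:
  assumes "rpoly p" "F \<in> monomial_span"
  shows "(\<lambda>x. p x * F x) \<in> monomial_span"
  using assms
proof (induction p arbitrary: F)
  case (linear f)
  have "(\<lambda>x. f x * F x) = (\<lambda>x. \<Sum>b\<in>Basis. f b * ((x \<bullet> b) * F x))"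
    by (rule ext, subst bounded_linear_expand[OF linear.hyps]) (simp only: sum_distrib_right mult.assoc)
  then show ?case
    using linear.prems
    by (simp only:) (intro monomial_span_sum monomial_span_cmult monomial_span_inner finite_Basis)
next
  case (add f g)
  then show ?case by (auto simp: ring_distribs intro!: monomial_span_add)
next
  case (mult f g)
  then show ?case by (auto simp: mult.assoc)
qed (auto intro: monomial_span_cmult)

lemma rpoly_in_monomial_span:
  assumes "rpoly p" shows "p \<in> monomial_span"
proof -
  have "(\<lambda>x. 1 * monomial (\<lambda>_. 0) x + 0) \<in> monomial_span"
    by (intro monomial_span.intros)
  then have "(\<lambda>x. 1) \<in> monomial_span" by (simp add: monomial_def)
  from monomial_span_poly_mult[OF assms this] show ?thesis by simp
qed

lemma gint_add: "gint f \<Longrightarrow> gint g \<Longrightarrow> gint (\<lambda>x. f x + g x)"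
  by (simp add: gint_def distrib_left)

lemma gint_cmult: "gint f \<Longrightarrow> gint (\<lambda>x. c * f x)"
  by (simp add: gint_def mult.left_commute[of _ c])

lemma gint_rpoly:
  assumes "rpoly p" shows "gint p"
  using rpoly_in_monomial_span[OF assms]
proof induction
  case zero
  then show ?case by (simp add: gint_def)
qed (intro gint_add gint_cmult gint_monomial)

lemma gexp_add: "rpoly f \<Longrightarrow> rpoly g \<Longrightarrow> gexp (\<lambda>x. f x + g x) = gexp f + gexp g"
  using gint_rpoly[of f] gint_rpoly[of g] by (simp add: gexp_def gint_def distrib_left)

lemma gexp_diff: "rpoly f \<Longrightarrow> rpoly g \<Longrightarrow> gexp (\<lambda>x. f x - g x) = gexp f - gexp g"
  using gint_rpoly[of f] gint_rpoly[of g] by (simp add: gexp_def gint_def right_diff_distrib)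

lemma gexp_zero: "gexp (\<lambda>x. 0) = 0"
  by (simp add: gexp_def)

lemma gexp_sum:
  "finite I \<Longrightarrow> (\<And>i. i \<in> I \<Longrightarrow> rpoly (f i)) \<Longrightarrow> gexp (\<lambda>x. \<Sum>i\<in>I. f i x) = (\<Sum>i\<in>I. gexp (f i))"
proof (induction rule: finite_induct)
  case (insert i I)
  then have "rpoly (f i)" "rpoly (\<lambda>x. \<Sum>i\<in>I. f i x)" by auto
  with insert show ?case by (simp add: gexp_add)
qed (simp add: gexp_zero)

lemma gexp_one: "gexp (\<lambda>x :: 'a::euclidean_space. 1) = 1"
proof -
  have "moment 0 = 1"
    using integral_std_normal_moment_even[of 0] by (simp add: moment_def)
  moreover have "monomial (\<lambda>_. 0) = (\<lambda>_ :: 'a. 1)" by (simp add: monomial_def fun_eq_iff)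
  ultimately show ?thesis using gexp_monomial[of "\<lambda>_ :: 'a. 0"] by simp
qed

lemma gexp_by_parts:
  assumes "rpoly p" and b: "b \<in> Basis"
  shows "gexp (\<lambda>x. (x \<bullet> b) * p x) = gexp (dir_deriv b p)"
proof -
  have "rpoly p \<and> gexp (\<lambda>x. (x \<bullet> b) * p x) = gexp (dir_deriv b p)"
    using rpoly_in_monomial_span[OF assms(1)]
  proof induction
    case zero
    then show ?case by (auto simp: dir_deriv_const)
  next
    case (step F c i)
    then have F: "rpoly F" by simp
    have m: "rpoly (\<lambda>x. c * monomial i x)" by (intro rpoly_cmult rpoly_monomial)
    have "gexp (\<lambda>x. (x \<bullet> b) * (c * monomial i x + F x))
        = gexp (\<lambda>x. c * ((x \<bullet> b) * monomial i x) + (x \<bullet> b) * F x)"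
      by (simp add: algebra_simps)
    also have "\<dots> = c * gexp (\<lambda>x. (x \<bullet> b) * monomial i x) + gexp (\<lambda>x. (x \<bullet> b) * F x)"
      by (subst gexp_add) (auto intro!: rpoly_intros rpoly_monomial F simp: gexp_cmult)
    also have "\<dots> = c * gexp (dir_deriv b (monomial i)) + gexp (dir_deriv b F)"
      using step.IH gexp_monomial_by_parts[OF b] by simp
    also have "\<dots> = gexp (dir_deriv b (\<lambda>x. c * monomial i x + F x))"
      by (subst dir_deriv_add[OF m F], subst dir_deriv_cmult[OF rpoly_monomial], subst gexp_add)
        (auto intro!: rpoly_intros rpoly_monomial F simp: gexp_cmult)
    finally show ?case using F m by (auto intro: rpoly_intros)
  qed
  then show ?thesis ..
qed

lemma gauss_density_pos: "0 < gauss_density x"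
  unfolding gauss_density_def by (intro prod_pos ballI) (simp add: normal_density_pos)

lemma gexp_nonneg: "(\<And>x. 0 \<le> p x) \<Longrightarrow> 0 \<le> gexp p"
  unfolding gexp_def by (intro Bochner_Integration.integral_nonneg) (simp add: gauss_density_pos less_imp_le)

text \<open>
  Zero expectation makes the nonnegative \<open>p\<close> vanish almost everywhere, and the set where the
  continuous function \<open>p\<close> is nonzero is open, so it is empty if it is a null set.
\<close>

lemma gexp_eq_0D:
  fixes p :: "'a::euclidean_space \<Rightarrow> real"
  assumes p: "rpoly p" "\<And>x. 0 \<le> p x" and "gexp p = 0"
  shows "p x = 0"
proof (rule ccontr)
  assume "p x \<noteq> 0"
  have nz: "gauss_density x \<noteq> 0" for x :: 'a using gauss_density_pos[of x] by simp
  have "AE x in lborel. gauss_density x * p x = 0"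
    using gint_rpoly[OF p(1)] assms(3) p(2) less_imp_le[OF gauss_density_pos]
    by (subst integral_nonneg_eq_0_iff_AE[symmetric]) (auto simp: gint_def gexp_def intro!: AE_I2 mult_nonneg_nonneg)
  then have "AE x in lborel. x \<notin> {x. p x \<noteq> 0}"
    by eventually_elim (simp add: nz)
  moreover have op: "open {x. p x \<noteq> 0}"
    using continuous_on_rpoly[OF p(1)] by (intro open_Collect_neq continuous_on_const)
  ultimately have "{x. p x \<noteq> 0} \<in> null_sets lborel"
    by (subst (asm) AE_iff_null_sets[symmetric]) auto
  then have "negligible {x. p x \<noteq> 0}"
    by (simp add: negligible_iff_null_sets null_sets_completionI)
  with op open_not_negligible[of "{x. p x \<noteq> 0}"] \<open>p x \<noteq> 0\<close> show False by auto
qed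

text \<open>
  The standard Gaussian measure on a product space is a product measure: the two components of
  a standard Gaussian vector are independent.
\<close>

lemma gexp_pair:
  fixes f :: "'a::euclidean_space \<Rightarrow> real" and g :: "'b::euclidean_space \<Rightarrow> real"
  assumes f: "rpoly f" and g: "rpoly g"
  shows "gexp (\<lambda>z. f (fst z) * g (snd z)) = gexp f * gexp g"
proof -
  let ?h = "\<lambda>x y. (gauss_density x * f x) * (gauss_density y * g y)"
  have Basis: "(\<Prod>c\<in>(Basis :: ('a \<times> 'b) set). h c) = (\<Prod>c\<in>Basis. h (c, 0)) * (\<Prod>c\<in>Basis. h (0, c))"
    for h :: "'a \<times> 'b \<Rightarrow> real"
    unfolding Basis_prod_def
    by (subst prod.union_disjoint) (auto simp: prod.reindex inj_on_def dest: nonzero_Basis)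
  have dens: "gauss_density (z :: 'a \<times> 'b) = gauss_density (fst z) * gauss_density (snd z)" for z
    unfolding gauss_density_def Basis by (simp add: inner_prod_def)
  have eq: "gauss_density z * (f (fst z) * g (snd z)) = (case z of (x, y) \<Rightarrow> ?h x y)" for z
    unfolding dens case_prod_unfold by (simp only: mult.assoc mult.left_commute)
  have "rpoly (\<lambda>z. f (fst z) * g (snd z))"
    by (intro real_polynomial_function.intros(4) rpoly_compose_linear[OF f bounded_linear_fst]
        rpoly_compose_linear[OF g bounded_linear_snd])
  from gint_rpoly[OF this]
  have int: "integrable (lborel \<Otimes>\<^sub>M lborel) (\<lambda>(x, y). ?h x y)"
    unfolding gint_def eq lborel_prod .
  have "gexp (\<lambda>z. f (fst z) * g (snd z)) = (\<integral>z. (case z of (x, y) \<Rightarrow> ?h x y) \<partial>(lborel \<Otimes>\<^sub>M lborel))"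
    unfolding gexp_def eq lborel_prod ..
  also have "\<dots> = (\<integral>x. (\<integral>y. ?h x y \<partial>lborel) \<partial>lborel)"
    using lborel_pair.integral_fst'[OF int] by simp
  also have "\<dots> = gexp f * gexp g" by (simp add: gexp_def)
  finally show ?thesis .
qed

section \<open>The Ornstein-Uhlenbeck operator on polynomials\<close>

text \<open>
  This is the \<^emph>\<open>carre du champ\<close> \<open>\<Gamma>(f, g) = \<langle>\<nabla>f, \<nabla>g\<rangle>\<close> of the operator \<open>\<L>\<close> defined below.
\<close>

definition carre :: "('a::euclidean_space \<Rightarrow> real) \<Rightarrow> ('a \<Rightarrow> real) \<Rightarrow> 'a \<Rightarrow> real" where
  "carre f g x = (\<Sum>b\<in>Basis. dir_deriv b f x * dir_deriv b g x)"

text \<open>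
  On \<open>\<real>\<^sup>n\<close> this agrees with \<^const>\<open>OU\<close> for polynomials; the present form makes sense on every
  Euclidean space, in particular on products.
\<close>

definition ou :: "('a::euclidean_space \<Rightarrow> real) \<Rightarrow> 'a \<Rightarrow> real" where
  "ou f x = (\<Sum>b\<in>Basis. dir_deriv b (dir_deriv b f) x - (x \<bullet> b) * dir_deriv b f x)"

lemma rpoly_carre: "rpoly f \<Longrightarrow> rpoly g \<Longrightarrow> rpoly (carre f g)"
  unfolding carre_def[abs_def] by (intro rpoly_intros)

lemma rpoly_ou: "rpoly f \<Longrightarrow> rpoly (ou f)"
  unfolding ou_def[abs_def] by (intro rpoly_intros)

text \<open>
  The factor \<open>x \<bullet> b\<close> in \<open>\<L>\<close> is removed by Gaussian integration by parts, which cancels the second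
  derivatives.  In particular \<open>\<L>\<close> is symmetric and negative semidefinite.
\<close>

lemma gexp_mult_ou:
  assumes f: "rpoly f" and g: "rpoly g"
  shows "gexp (\<lambda>x. f x * ou g x) = - gexp (carre f g)"
proof -
  have "gexp (\<lambda>x. f x * dir_deriv b (dir_deriv b g) x - (x \<bullet> b) * (f x * dir_deriv b g x))
      = - gexp (\<lambda>x. dir_deriv b f x * dir_deriv b g x)" if b: "b \<in> Basis" for b
  proof -
    have "gexp (\<lambda>x. (x \<bullet> b) * (f x * dir_deriv b g x))
        = gexp (\<lambda>x. f x * dir_deriv b (dir_deriv b g) x + dir_deriv b f x * dir_deriv b g x)"
      by (subst gexp_by_parts[OF _ b]) (auto intro!: rpoly_intros f g simp: dir_deriv_mult f g rpoly_dir_deriv)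
    also have "\<dots> = gexp (\<lambda>x. f x * dir_deriv b (dir_deriv b g) x) + gexp (\<lambda>x. dir_deriv b f x * dir_deriv b g x)"
      by (rule gexp_add) (intro rpoly_intros f g)+
    moreover have "gexp (\<lambda>x. f x * dir_deriv b (dir_deriv b g) x - (x \<bullet> b) * (f x * dir_deriv b g x))
      = gexp (\<lambda>x. f x * dir_deriv b (dir_deriv b g) x) - gexp (\<lambda>x. (x \<bullet> b) * (f x * dir_deriv b g x))"
      by (rule gexp_diff) (intro rpoly_intros f g)+
    ultimately show ?thesis by simp
  qed
  note parts = this
  have "gexp (\<lambda>x. f x * ou g x)
      = gexp (\<lambda>x. \<Sum>b\<in>Basis. f x * dir_deriv b (dir_deriv b g) x - (x \<bullet> b) * (f x * dir_deriv b g x))"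
    by (simp add: ou_def sum_distrib_left right_diff_distrib mult.left_commute)
  also have "\<dots> = (\<Sum>b\<in>Basis. - gexp (\<lambda>x. dir_deriv b f x * dir_deriv b g x))"
    by (subst gexp_sum) (auto intro!: rpoly_intros f g sum.cong parts)
  also have "\<dots> = - gexp (carre f g)"
    unfolding carre_def[abs_def]
    by (subst gexp_sum) (auto intro!: rpoly_intros f g simp: sum_negf)
  finally show ?thesis .
qed

lemma ou_mult:
  assumes f: "rpoly f" and g: "rpoly g"
  shows "ou (\<lambda>x. f x * g x) x = f x * ou g x + ou f x * g x + 2 * carre f g x"
  by (simp add: ou_def carre_def dir_deriv_mult dir_deriv_add rpoly_dir_deriv real_polynomial_function.intros(4)
      f g sum_distrib_left sum_distrib_right sum.distrib[symmetric] algebra_simps)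

text \<open>
  The commutator of \<open>\<partial>\<^sub>c\<close> with \<open>\<langle>x, \<nabla>\<rangle>\<close> is \<open>\<partial>\<^sub>c\<close>, and \<open>\<partial>\<^sub>c\<close> commutes with the Laplacian.
  Consequently differentiation lowers the eigenvalue of an eigenfunction of \<open>- \<L>\<close> by one, unless
  it annihilates the function.
\<close>

lemma dir_deriv_ou:
  assumes f: "rpoly f" and c: "c \<in> Basis"
  shows "dir_deriv c (ou f) x = ou (dir_deriv c f) x - dir_deriv c f x"
proof -
  have inner: "dir_deriv c (\<lambda>x. x \<bullet> b) = (\<lambda>_. c \<bullet> b)" for b :: 'a
    by (rule dir_deriv_bounded_linear) (rule bounded_linear_inner_left)
  have com: "dir_deriv c (dir_deriv b (dir_deriv b f)) = dir_deriv b (dir_deriv b (dir_deriv c f))"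
    "dir_deriv c (dir_deriv b f) = dir_deriv b (dir_deriv c f)" for b
    using dir_deriv_commute[OF rpoly_dir_deriv[OF f, of b], of c b] dir_deriv_commute[OF f, of c b] by auto
  have "dir_deriv c (ou f) x = (\<Sum>b\<in>Basis. dir_deriv b (dir_deriv b (dir_deriv c f)) x
      - ((x \<bullet> b) * dir_deriv b (dir_deriv c f) x + (c \<bullet> b) * dir_deriv b f x))"
    unfolding ou_def[abs_def]
    by (subst dir_deriv_sum) (auto intro!: rpoly_intros f sum.cong
        simp: dir_deriv_diff dir_deriv_mult rpoly_intros f inner com)
  also have "\<dots> = ou (dir_deriv c f) x - (\<Sum>b\<in>Basis. (c \<bullet> b) * dir_deriv b f x)"
    by (simp add: ou_def sum_subtractf sum.distrib)
  also have "(\<Sum>b\<in>Basis. (c \<bullet> b) * dir_deriv b f x) = dir_deriv c f x"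
    by (rule dir_deriv_expand[OF f, symmetric])
  finally show ?thesis .
qed

text \<open>
  An integrated Bochner formula.  Since \<open>E[(\<L>f)\<^sup>2] = - E[\<Gamma>(\<L>f, f)]\<close>, it comes from moving the
  derivatives in \<open>\<Gamma>(\<L>f, f)\<close> past \<open>\<L>\<close>.  It reduces a statement on \<open>f\<close> to one on its
  partial derivatives, which have smaller degree.
\<close>

lemma gexp_ou_squared:
  assumes f: "rpoly f"
  shows "gexp (\<lambda>x. (ou f x)\<^sup>2)
    = gexp (carre f f) + (\<Sum>b\<in>Basis. gexp (carre (dir_deriv b f) (dir_deriv b f)))"
proof -
  have df: "rpoly (dir_deriv b f)" for b by (rule rpoly_dir_deriv[OF f])
  have "gexp (\<lambda>x. (ou f x)\<^sup>2) = - gexp (carre (ou f) f)"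
    using gexp_mult_ou[OF rpoly_ou[OF f] f] by (simp add: power2_eq_square)
  also have "carre (ou f) f = (\<lambda>x. (\<Sum>b\<in>Basis. dir_deriv b f x * ou (dir_deriv b f) x) - carre f f x)"
    by (simp add: carre_def[abs_def] fun_eq_iff dir_deriv_ou[OF f] right_diff_distrib left_diff_distrib sum_subtractf mult.commute)
  also have "- gexp \<dots> = gexp (carre f f) - (\<Sum>b\<in>Basis. gexp (\<lambda>x. dir_deriv b f x * ou (dir_deriv b f) x))"
    by (subst gexp_diff) (auto intro!: rpoly_intros rpoly_ou rpoly_carre f simp: gexp_sum rpoly_intros rpoly_ou f)
  also have "\<dots> = gexp (carre f f) + (\<Sum>b\<in>Basis. gexp (carre (dir_deriv b f) (dir_deriv b f)))"
    by (simp add: gexp_mult_ou df sum_negf)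
  finally show ?thesis .
qed

section \<open>A reverse Poincare inequality\<close>

text \<open>
  A polynomial has degree at most \<open>d\<close> iff its derivatives of order \<open>d + 1\<close> vanish; this
  description fits inductions that differentiate.
\<close>

fun deg_le :: "nat \<Rightarrow> ('a::euclidean_space \<Rightarrow> real) \<Rightarrow> bool" where
  "deg_le 0 f \<longleftrightarrow> (\<forall>b\<in>Basis. dir_deriv b f = (\<lambda>_. 0))"
| "deg_le (Suc d) f \<longleftrightarrow> (\<forall>b\<in>Basis. deg_le d (dir_deriv b f))"

text \<open>
  On polynomials of degree at most \<open>d\<close> the spectrum of \<open>- \<L>\<close> is \<open>{0, \<dots>, d}\<close>, which explains the
  inequality and its equality case.  The proof is by induction on \<open>d\<close>.
  With \<open>d\<close> replaced by \<open>d + 1\<close>, the induction hypothesis for the partial derivatives and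
  \<open>gexp_ou_squared\<close> give \<open>E[(\<L>f)\<^sup>2] \<le> (d + 1) E[\<Gamma>(f, f)]\<close>; expanding the square yields
  \<open>0 \<le> E[(\<L>f + (d + 1) f)\<^sup>2] \<le> (d + 1) ((d + 1) E[f\<^sup>2] - E[\<Gamma>(f, f)])\<close>,
  which contains both claims.
\<close>

lemma reverse_poincare:
  assumes "rpoly f" "deg_le d f"
  shows "gexp (carre f f) \<le> real d * gexp (\<lambda>x. (f x)\<^sup>2)"
    and "gexp (carre f f) = real d * gexp (\<lambda>x. (f x)\<^sup>2) \<Longrightarrow> ou f x = - real d * f x"
proof -
  have "gexp (carre f f) \<le> real d * gexp (\<lambda>x. (f x)\<^sup>2) \<and>
    (gexp (carre f f) = real d * gexp (\<lambda>x. (f x)\<^sup>2) \<longrightarrow> (\<forall>x. ou f x = - real d * f x))"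
    using assms
  proof (induction d arbitrary: f)
    case 0
    then show ?case by (auto simp: carre_def[abs_def] ou_def dir_deriv_const gexp_zero)
  next
    case (Suc d)
    let ?d = "real (Suc d)"
    have f: "rpoly f" by (rule Suc.prems)
    have gr: "gexp (carre f f) = (\<Sum>b\<in>Basis. gexp (\<lambda>x. (dir_deriv b f x)\<^sup>2))"
      unfolding carre_def[abs_def] power2_eq_square by (subst gexp_sum) (auto intro!: rpoly_intros f)
    have "(\<Sum>b\<in>Basis. gexp (carre (dir_deriv b f) (dir_deriv b f)))
        \<le> (\<Sum>b\<in>Basis. real d * gexp (\<lambda>x. (dir_deriv b f x)\<^sup>2))"
      using Suc by (intro sum_mono) (auto intro: rpoly_dir_deriv)
    then have le: "gexp (\<lambda>x. (ou f x)\<^sup>2) \<le> ?d * gexp (carre f f)"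
      unfolding gexp_ou_squared[OF f] by (simp add: gr sum_distrib_left distrib_right sum.distrib)
    have poly: "rpoly (\<lambda>x. (ou f x + ?d * f x)\<^sup>2)" by (intro rpoly_intros rpoly_ou f)
    have "(\<lambda>x. (ou f x + ?d * f x)\<^sup>2) = (\<lambda>x. (ou f x)\<^sup>2 + (2 * ?d) * (f x * ou f x) + ?d\<^sup>2 * (f x)\<^sup>2)"
      by (simp add: power2_eq_square algebra_simps)
    then have "gexp (\<lambda>x. (ou f x + ?d * f x)\<^sup>2)
        = gexp (\<lambda>x. (ou f x)\<^sup>2) + (2 * ?d) * gexp (\<lambda>x. f x * ou f x) + ?d\<^sup>2 * gexp (\<lambda>x. (f x)\<^sup>2)"
      by (simp only:) (subst gexp_add, (intro rpoly_intros rpoly_ou f)+, 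
          subst gexp_add, (intro rpoly_intros rpoly_ou f)+, simp only: gexp_cmult)
    also have "\<dots> \<le> ?d * (?d * gexp (\<lambda>x. (f x)\<^sup>2) - gexp (carre f f))"
      using le by (simp only: gexp_mult_ou[OF f f]) (simp add: power2_eq_square algebra_simps)
    finally have key: "gexp (\<lambda>x. (ou f x + ?d * f x)\<^sup>2) \<le> ?d * (?d * gexp (\<lambda>x. (f x)\<^sup>2) - gexp (carre f f))" .
    have nn: "0 \<le> gexp (\<lambda>x. (ou f x + ?d * f x)\<^sup>2)" by (intro gexp_nonneg) simp
    have "0 \<le> ?d * (?d * gexp (\<lambda>x. (f x)\<^sup>2) - gexp (carre f f))" using key nn by linarith
    then have "0 \<le> ?d * gexp (\<lambda>x. (f x)\<^sup>2) - gexp (carre f f)" 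
      by (simp only: zero_le_mult_iff) auto
    moreover have "ou f x = - ?d * f x" if "gexp (carre f f) = ?d * gexp (\<lambda>x. (f x)\<^sup>2)" for x
    proof -
      have "gexp (\<lambda>x. (ou f x + ?d * f x)\<^sup>2) = 0" using key nn that by simp
      from gexp_eq_0D[OF poly _ this, of x] show ?thesis by (simp add: algebra_simps)
    qed
    ultimately show ?case by (auto simp del: of_nat_Suc)
  qed
  then show "gexp (carre f f) \<le> real d * gexp (\<lambda>x. (f x)\<^sup>2)"
    and "gexp (carre f f) = real d * gexp (\<lambda>x. (f x)\<^sup>2) \<Longrightarrow> ou f x = - real d * f x" by blast+
qed

section \<open>Products of eigenfunctions\<close>

text \<open>
  The kernel of \<open>\<L> + k Id\<close> on the polynomials of an arbitrary Euclidean space.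
\<close>

definition eigen :: "nat \<Rightarrow> ('a::euclidean_space \<Rightarrow> real) \<Rightarrow> bool" where
  "eigen k f \<longleftrightarrow> rpoly f \<and> (\<forall>x. ou f x = - real k * f x)"

text \<open>
  Each derivative lowers the eigenvalue by one, so \<open>k\<close> derivatives lead to the kernel of \<open>\<L>\<close>,
  and \<open>E[\<Gamma>(f, f)] = - E[f \<L>f]\<close> shows that this kernel consists of constants.
\<close>

lemma eigen_deg_le: "eigen k f \<Longrightarrow> deg_le k f"
proof (induction k arbitrary: f)
  case 0
  then have f: "rpoly f" "ou f = (\<lambda>_. 0)" by (auto simp: eigen_def)
  have "gexp (carre f f) = 0"
    using gexp_mult_ou[OF f(1) f(1)] by (simp add: f(2) gexp_zero)
  then have "carre f f x = 0" for x
    by (intro gexp_eq_0D[OF rpoly_carre[OF f(1) f(1)]]) (auto simp: carre_def sum_nonneg)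
  then show ?case by (auto simp: carre_def sum_nonneg_eq_0_iff fun_eq_iff)
next
  case (Suc k)
  have f: "rpoly f" "ou f = (\<lambda>x. - real (Suc k) * f x)"
    using Suc.prems unfolding eigen_def by (blast, intro ext, blast)
  have "eigen k (dir_deriv b f)" if b: "b \<in> Basis" for b
  proof -
    have "ou (dir_deriv b f) x = - real k * dir_deriv b f x" for x
      using dir_deriv_ou[OF f(1) b, of x] unfolding f(2) dir_deriv_cmult[OF f(1)] 
      by (simp add: algebra_simps)
    with f(1) show ?thesis by (simp add: eigen_def rpoly_dir_deriv)
  qed
  with Suc.IH show ?case by simp
qed

lemma deg_le_zero: "deg_le d (\<lambda>_. 0)"
  by (induction d) (auto simp: dir_deriv_const)

lemma deg_le_add:
  "rpoly f \<Longrightarrow> rpoly g \<Longrightarrow> deg_le d f \<Longrightarrow> deg_le d g \<Longrightarrow> deg_le d (\<lambda>x. f x + g x)"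
  by (induction d arbitrary: f g) (auto simp: dir_deriv_add rpoly_dir_deriv)

lemma deg_le_mult:
  "rpoly f \<Longrightarrow> rpoly g \<Longrightarrow> deg_le k f \<Longrightarrow> deg_le l g \<Longrightarrow> deg_le (k + l) (\<lambda>x. f x * g x)"
proof (induction "k + l" arbitrary: k l f g)
  case 0
  then show ?case by (auto simp: dir_deriv_mult)
next
  case (Suc n)
  have df: "rpoly (dir_deriv b f)" and dg: "rpoly (dir_deriv b g)" for b
    using Suc.prems by (auto intro: rpoly_dir_deriv)
  have 1: "deg_le n (\<lambda>x. f x * dir_deriv b g x)" if b: "b \<in> Basis" for b
  proof (cases l)
    case 0
    then have "dir_deriv b g = (\<lambda>_. 0)" using Suc.prems(4) b by simp
    then show ?thesis by (simp add: deg_le_zero)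
  next
    case (Suc l')
    then show ?thesis using Suc.hyps(1)[of k l' f "dir_deriv b g"] Suc.hyps(2) Suc.prems df dg b by auto
  qed
  have 2: "deg_le n (\<lambda>x. dir_deriv b f x * g x)" if b: "b \<in> Basis" for b
  proof (cases k)
    case 0
    then have "dir_deriv b f = (\<lambda>_. 0)" using Suc.prems(3) b by simp
    then show ?thesis by (simp add: deg_le_zero)
  next
    case (Suc k')
    then show ?thesis using Suc.hyps(1)[of k' l "dir_deriv b f" g] Suc.hyps(2) Suc.prems df dg b by auto
  qed
  have "deg_le (Suc n) (\<lambda>x. f x * g x)"
    using 1 2 Suc.prems df dg by (auto simp: dir_deriv_mult intro!: deg_le_add rpoly_intros)
  then show ?case using Suc.hyps(2) by simp
qed

text \<open>
  By the product rule \<open>\<L>(f g) = 2 \<Gamma>(f, g) - (k + l) f g\<close>, the expectation in question is half the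
  gap in the reverse Poincare inequality for \<open>f g\<close>, a polynomial of degree at most \<open>k + l\<close>.  If
  there is no gap, then \<open>f g\<close> is itself an eigenfunction and the product rule leaves \<open>\<Gamma>(f, g) = 0\<close>.
\<close>

lemma
  assumes f: "eigen k f" and g: "eigen l g"
  shows eigen_carre_nonneg: "0 \<le> gexp (\<lambda>x. f x * g x * carre f g x)"
    and eigen_carre_zero: "gexp (\<lambda>x. f x * g x * carre f g x) = 0 \<Longrightarrow> carre f g x = 0"
proof -
  let ?h = "\<lambda>x. f x * g x"
  have p: "rpoly f" "rpoly g" using f g by (auto simp: eigen_def)
  have h: "rpoly ?h" "deg_le (k + l) ?h"
    using p eigen_deg_le[OF f] eigen_deg_le[OF g] by (auto intro: rpoly_intros deg_le_mult)
  have ou: "ou ?h x = 2 * carre f g x - real (k + l) * ?h x" for x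
    using f g by (simp add: ou_mult p eigen_def algebra_simps)
  have "gexp (carre ?h ?h) = - gexp (\<lambda>x. ?h x * ou ?h x)"
    by (simp add: gexp_mult_ou h)
  also have "(\<lambda>x. ?h x * ou ?h x) = (\<lambda>x. 2 * (?h x * carre f g x) - real (k + l) * (?h x)\<^sup>2)"
    by (simp add: ou power2_eq_square algebra_simps)
  also have "- gexp \<dots> = real (k + l) * gexp (\<lambda>x. (?h x)\<^sup>2) - 2 * gexp (\<lambda>x. ?h x * carre f g x)"
    by (subst gexp_diff) (auto intro!: rpoly_intros rpoly_carre p simp: gexp_cmult simp del: of_nat_add)
  finally have eq: "gexp (carre ?h ?h) =
      real (k + l) * gexp (\<lambda>x. (?h x)\<^sup>2) - 2 * gexp (\<lambda>x. ?h x * carre f g x)" .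
  with reverse_poincare(1)[OF h] show "0 \<le> gexp (\<lambda>x. ?h x * carre f g x)" by linarith
  assume "gexp (\<lambda>x. ?h x * carre f g x) = 0"
  with eq have "ou ?h x = - real (k + l) * ?h x" by (intro reverse_poincare(2)[OF h]) simp
  with ou[of x] show "carre f g x = 0" by (simp add: algebra_simps)
qed

section \<open>Rotating one of two independent copies into the other\<close>

text \<open>
  Time-dependent polynomials with finitely many differentiable coefficients, paired with their
  time derivatives.  For these, differentiation under the expectation is mere linearity.
\<close>

inductive poly_path :: "(real \<Rightarrow> 'a::real_normed_vector \<Rightarrow> real) \<Rightarrow> (real \<Rightarrow> 'a \<Rightarrow> real) \<Rightarrow> bool" where
  basic: "(\<And>t. (a has_real_derivative a' t) (at t)) \<Longrightarrow> rpoly m \<Longrightarrow>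
    poly_path (\<lambda>t x. a t * m x) (\<lambda>t x. a' t * m x)"
| sum: "poly_path f f' \<Longrightarrow> poly_path g g' \<Longrightarrow>
    poly_path (\<lambda>t x. f t x + g t x) (\<lambda>t x. f' t x + g' t x)"

lemma poly_path_const: "rpoly p \<Longrightarrow> poly_path (\<lambda>t. p) (\<lambda>t x. 0)"
  using poly_path.basic[of "\<lambda>_. 1" "\<lambda>_. 0" p] by simp

lemma poly_path_mult:
  assumes "poly_path f f'" "poly_path g g'"
  shows "poly_path (\<lambda>t x. f t x * g t x) (\<lambda>t x. f' t x * g t x + f t x * g' t x)"
  using assms
proof (induction arbitrary: g g' rule: poly_path.induct)
  case (basic a a' m)
  note a = basic.hyps
  show ?case using basic.prems
  proof (induction rule: poly_path.induct)
    case (basic b b' n)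
    have "((\<lambda>t. a t * b t) has_real_derivative a' t * b t + a t * b' t) (at t)" for t
      using DERIV_mult[OF a(1) basic(1)] by (simp add: mult.commute)
    from poly_path.basic[OF this real_polynomial_function.intros(4)[OF a(2) basic(2)]]
    show ?case by (simp add: algebra_simps)
  next
    case (sum g g' h h')
    from poly_path.sum[OF sum.IH] show ?case by (simp add: algebra_simps)
  qed
next
  case (sum f f' h h')
  from poly_path.sum[OF sum.IH(1)[OF sum.prems] sum.IH(2)[OF sum.prems]]
  show ?case by (simp add: algebra_simps)
qed

lemma poly_path_gexp:
  assumes "poly_path f f'"
  shows "((\<lambda>t. gexp (f t)) has_real_derivative gexp (f' t)) (at t)"
proof -
  have "(\<forall>t. rpoly (f t) \<and> rpoly (f' t)) \<and> ((\<lambda>t. gexp (f t)) has_real_derivative gexp (f' t)) (at t)"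
    using assms
  proof (induction rule: poly_path.induct)
    case (basic a a' m)
    then show ?case by (auto simp: gexp_cmult intro!: rpoly_intros DERIV_cmult_right)
  next
    case (sum f f' g g')
    then show ?case by (auto simp: gexp_add intro!: rpoly_intros DERIV_add)
  qed
  then show ?thesis ..
qed

definition mix :: "real \<Rightarrow> real \<Rightarrow> 'a \<times> 'a \<Rightarrow> 'a::real_normed_vector" where
  "mix c s z = c *\<^sub>R fst z + s *\<^sub>R snd z"

lemma bounded_linear_mix: "bounded_linear (mix c s)"
  unfolding mix_def[abs_def]
  by (intro bounded_linear_add bounded_linear_scaleR_right[THEN bounded_linear_compose]
      bounded_linear_fst bounded_linear_snd)

lemma inner_mix: "mix c s z \<bullet> b = c * (z \<bullet> (b, 0)) + s * (z \<bullet> (0, b))"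
  by (simp add: mix_def inner_add_left inner_prod_def)

lemma rpoly_mix: "rpoly f \<Longrightarrow> rpoly (\<lambda>z. f (mix c s z))"
  by (rule rpoly_compose_linear[OF _ bounded_linear_mix])

lemma rpoly_fst: "rpoly f \<Longrightarrow> rpoly (\<lambda>z. f (fst z))"
  by (rule rpoly_compose_linear[OF _ bounded_linear_fst])

lemma dir_deriv_mix:
  assumes "rpoly f"
  shows "dir_deriv (b, 0) (\<lambda>z. f (mix c s z)) = (\<lambda>z. c * dir_deriv b f (mix c s z))"
    and "dir_deriv (0, b) (\<lambda>z. f (mix c s z)) = (\<lambda>z. s * dir_deriv b f (mix c s z))"
  by (simp_all add: dir_deriv_compose_linear[OF assms bounded_linear_mix] dir_deriv_scale[OF assms]
      mix_def[of c s "(b, 0)"] mix_def[of c s "(0, b)"])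

lemma dir_deriv_fst:
  assumes "rpoly f"
  shows "dir_deriv (b, 0) (\<lambda>z. f (fst z)) = (\<lambda>z. dir_deriv b f (fst z))"
    and "dir_deriv (0, b) (\<lambda>z. f (fst z)) = (\<lambda>z. 0)"
  by (simp_all add: dir_deriv_compose_linear[OF assms bounded_linear_fst] dir_deriv_zero[OF assms])

lemma sum_Basis_prod: 
  "(\<Sum>c\<in>(Basis :: ('a::euclidean_space \<times> 'b::euclidean_space) set). h c)
    = (\<Sum>b\<in>Basis. h (b, 0)) + (\<Sum>b\<in>Basis. h (0, b))"
  unfolding Basis_prod_def
  by (subst sum.union_disjoint) (auto simp: sum.reindex inj_on_def dest: nonzero_Basis)

text \<open>
  \<open>\<L>\<close> is invariant under rotations, and for \<open>c\<^sup>2 + s\<^sup>2 = 1\<close> the map \<open>mix c s\<close> is a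
  rotation of the product space followed by a projection to one factor.
\<close>

lemma eigen_mix:
  assumes f: "eigen k f" and cs: "c\<^sup>2 + s\<^sup>2 = 1"
  shows "eigen k (\<lambda>z. f (mix c s z))"
proof -
  have p: "rpoly f" using f by (simp add: eigen_def)
  have dd: "dir_deriv (b, 0) (dir_deriv (b, 0) (\<lambda>z. f (mix c s z))) z = c\<^sup>2 * dir_deriv b (dir_deriv b f) (mix c s z)"
    "dir_deriv (0, b) (dir_deriv (0, b) (\<lambda>z. f (mix c s z))) z = s\<^sup>2 * dir_deriv b (dir_deriv b f) (mix c s z)" for b z
    unfolding dir_deriv_mix[OF p]
    by (simp_all add: dir_deriv_cmult rpoly_mix rpoly_dir_deriv p dir_deriv_mix power2_eq_square)
  have "ou (\<lambda>z. f (mix c s z)) z = (\<Sum>b\<in>Basis. (c\<^sup>2 + s\<^sup>2) * dir_deriv b (dir_deriv b f) (mix c s z)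
      - (mix c s z \<bullet> b) * dir_deriv b f (mix c s z))" for z
    unfolding ou_def sum_Basis_prod sum.distrib[symmetric] dd
    by (intro sum.cong refl) (simp add: dir_deriv_mix p inner_mix algebra_simps)
  then have "ou (\<lambda>z. f (mix c s z)) z = ou f (mix c s z)" for z by (simp add: cs ou_def)
  then show ?thesis using f by (simp add: eigen_def rpoly_mix)
qed

lemma poly_path_mix:
  assumes "rpoly g"
  shows "poly_path (\<lambda>t z. g (mix (cos t) (sin t) z))
    (\<lambda>t z. dir_deriv (mix (- sin t) (cos t) z) g (mix (cos t) (sin t) z))"
  using assms
proof (induction rule: real_polynomial_function.induct)
  case (linear f)
  note lin = linear
  interpret bounded_linear f by fact
  have "poly_path (\<lambda>t z. cos t * f (fst z) + sin t * f (snd z)) (\<lambda>t z. (- sin t) * f (fst z) + cos t * f (snd z))"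
    by (intro poly_path.intros)
      (auto intro!: derivative_eq_intros real_polynomial_function.intros(1)
        bounded_linear_compose[OF lin] bounded_linear_fst bounded_linear_snd)
  then show ?case by (simp add: dir_deriv_bounded_linear[OF lin] mix_def add diff scaleR)
next
  case (const c)
  then show ?case by (simp only: dir_deriv_const) (rule poly_path_const[OF real_polynomial_function.intros(2)])
next
  case (add f g)
  then show ?case by (simp add: dir_deriv_add poly_path.sum)
next
  case (mult f g)
  from poly_path_mult[OF mult.IH] show ?case by (simp add: dir_deriv_mult mult.hyps add.commute)
qed

text \<open>
  The time derivative of \<open>x cos t + y sin t\<close> is \<open>- x sin t + y cos t\<close>.  Integration by parts removes its
  coordinates \<open>x \<bullet> b\<close> and \<open>y \<bullet> b\<close>.  Both produce second derivatives of \<open>g\<close>, with the factors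
  \<open>- sin t cos t\<close> and \<open>cos t sin t\<close>; these cancel, and only the term in which \<open>f\<close> is
  differentiated survives.
\<close>

lemma rotation_derivative:
  fixes f g :: "'a::euclidean_space \<Rightarrow> real"
  assumes f: "rpoly f" and g: "rpoly g"
  shows "((\<lambda>t. gexp (\<lambda>z. f (fst z) * g (mix (cos t) (sin t) z))) has_real_derivative
    - sin t * gexp (\<lambda>z. \<Sum>b\<in>Basis. dir_deriv b f (fst z) * dir_deriv b g (mix (cos t) (sin t) z))) (at t)"
proof -
  define R where "R = (mix (cos t) (sin t) :: 'a \<times> 'a \<Rightarrow> 'a)"
  let ?q = "\<lambda>b z. f (fst z) * dir_deriv b g (R z)"
  let ?e = "\<lambda>b z. dir_deriv b f (fst z) * dir_deriv b g (R z)"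
  let ?h = "\<lambda>b z. f (fst z) * dir_deriv b (dir_deriv b g) (R z)"
  note polys = rpoly_intros rpoly_fst rpoly_mix f g
  have q: "rpoly (?q b)" and e: "rpoly (?e b)" and h: "rpoly (?h b)" for b
    unfolding R_def by (intro polys)+
  have "poly_path (\<lambda>t z. f (fst z) * g (mix (cos t) (sin t) z))
    (\<lambda>t z. f (fst z) * dir_deriv (mix (- sin t) (cos t) z) g (mix (cos t) (sin t) z))"
    using poly_path_mult[OF poly_path_const[OF rpoly_fst[OF f]] poly_path_mix[OF g]] by simp
  from poly_path_gexp[OF this, of t]
  have deriv: "((\<lambda>t. gexp (\<lambda>z. f (fst z) * g (mix (cos t) (sin t) z))) has_real_derivative
      gexp (\<lambda>z. f (fst z) * dir_deriv (mix (- sin t) (cos t) z) g (R z))) (at t)"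
    unfolding R_def .
  have 1: "gexp (\<lambda>z. (z \<bullet> (b, 0)) * ?q b z) = cos t * gexp (?h b) + gexp (?e b)" if b: "b \<in> Basis" for b
  proof -
    have "dir_deriv (b, 0) (?q b) = (\<lambda>z. cos t * ?h b z + ?e b z)"
      unfolding R_def
      by (simp add: dir_deriv_mult rpoly_fst rpoly_mix rpoly_dir_deriv f g dir_deriv_mix dir_deriv_fst algebra_simps)
    moreover have "(b, 0) \<in> (Basis :: ('a \<times> 'a) set)" using b by (simp add: Basis_prod_def)
    ultimately show ?thesis
      by (subst gexp_by_parts[OF q]) (auto simp: gexp_add gexp_cmult rpoly_cmult h e)
  qed
  have 2: "gexp (\<lambda>z. (z \<bullet> (0, b)) * ?q b z) = sin t * gexp (?h b)" if b: "b \<in> Basis" for b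
  proof -
    have "dir_deriv (0, b) (?q b) = (\<lambda>z. sin t * ?h b z)"
      unfolding R_def
      by (simp add: dir_deriv_mult rpoly_fst rpoly_mix rpoly_dir_deriv f g dir_deriv_mix dir_deriv_fst algebra_simps)
    moreover have "(0, b) \<in> (Basis :: ('a \<times> 'a) set)" using b by (simp add: Basis_prod_def)
    ultimately show ?thesis
      by (subst gexp_by_parts[OF q]) (auto simp: gexp_cmult)
  qed
  have zq: "rpoly (\<lambda>z. (z \<bullet> c) * ?q b z)" for b c
    by (intro real_polynomial_function.intros(4) rpoly_inner q)
  have split: "gexp (\<lambda>z. (- sin t) * ((z \<bullet> (b, 0)) * ?q b z) + cos t * ((z \<bullet> (0, b)) * ?q b z))
      = (- sin t) * gexp (\<lambda>z. (z \<bullet> (b, 0)) * ?q b z) + cos t * gexp (\<lambda>z. (z \<bullet> (0, b)) * ?q b z)" for b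
    unfolding gexp_add[OF rpoly_cmult[OF zq] rpoly_cmult[OF zq]] gexp_cmult ..
  have expand: "(\<lambda>z. f (fst z) * dir_deriv (mix (- sin t) (cos t) z) g (R z))
      = (\<lambda>z. \<Sum>b\<in>Basis. (- sin t) * ((z \<bullet> (b, 0)) * ?q b z) + cos t * ((z \<bullet> (0, b)) * ?q b z))"
    by (rule ext, subst dir_deriv_expand[OF g])
      (simp add: sum_distrib_left inner_mix[of "- sin t"] algebra_simps)
  have "gexp (\<lambda>z. f (fst z) * dir_deriv (mix (- sin t) (cos t) z) g (R z))
      = (\<Sum>b\<in>Basis. (- sin t) * gexp (\<lambda>z. (z \<bullet> (b, 0)) * ?q b z)
      + cos t * gexp (\<lambda>z. (z \<bullet> (0, b)) * ?q b z))"
    unfolding expand split[symmetric]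
    by (rule gexp_sum[OF finite_Basis])
      (rule real_polynomial_function.intros(3)[OF rpoly_cmult[OF zq] rpoly_cmult[OF zq]])
  also have "\<dots> = (\<Sum>b\<in>Basis. (- sin t) * gexp (?e b))"
    by (intro sum.cong refl) (simp only: 1 2, simp add: algebra_simps)
  also have "\<dots> = - sin t * gexp (\<lambda>z. \<Sum>b\<in>Basis. ?e b z)"
    by (simp add: gexp_sum e sum_distrib_left)
  finally show ?thesis using deriv by (simp add: R_def)
qed

text \<open>
  The two sides are the values at \<open>\<pi>/2\<close> and \<open>0\<close> of a function \<open>\<phi>\<close> that decreases because its
  derivative is \<open>- 4 sin t\<close> times a quantity \<open>D t\<close> that \<open>eigen_carre_nonneg\<close> shows to be
  nonnegative.  If the two values agree, then \<open>\<phi>\<close> is constant, so \<open>D\<close> vanishes inside the interval and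
  \<open>eigen_carre_zero\<close> applies.
\<close>

proposition
  fixes f g :: "'a::euclidean_space \<Rightarrow> real"
  assumes f: "eigen k f" and g: "eigen l g"
  shows squares_cov_nonneg:
      "gexp (\<lambda>x. (f x)\<^sup>2) * gexp (\<lambda>x. (g x)\<^sup>2) \<le> gexp (\<lambda>x. (f x)\<^sup>2 * (g x)\<^sup>2)"
    and squares_cov_zero:
      "gexp (\<lambda>x. (f x)\<^sup>2) * gexp (\<lambda>x. (g x)\<^sup>2) = gexp (\<lambda>x. (f x)\<^sup>2 * (g x)\<^sup>2) \<Longrightarrow>
        (\<Sum>b\<in>Basis. dir_deriv b f x * dir_deriv b g y) = 0"
proof -
  have p: "rpoly f" "rpoly g" using f g by (auto simp: eigen_def)
  define \<phi> where "\<phi> t = gexp (\<lambda>z. (f (fst z))\<^sup>2 * (g (mix (cos t) (sin t) z))\<^sup>2)" for t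
  define D where "D t = gexp (\<lambda>z. f (fst z) * g (mix (cos t) (sin t) z) *
      (\<Sum>b\<in>Basis. dir_deriv b f (fst z) * dir_deriv b g (mix (cos t) (sin t) z)))" for t
  have sq: "rpoly (\<lambda>x. (f x)\<^sup>2)" "rpoly (\<lambda>x. (g x)\<^sup>2)" by (intro rpoly_intros p)+
  have "dir_deriv b (\<lambda>x. (f x)\<^sup>2) = (\<lambda>x. 2 * (f x * dir_deriv b f x))"
    "dir_deriv b (\<lambda>x. (g x)\<^sup>2) = (\<lambda>x. 2 * (g x * dir_deriv b g x))" for b
    by (simp_all add: power2_eq_square dir_deriv_mult p mult.commute)
  then have "(\<phi> has_real_derivative - sin t * gexp (\<lambda>z. 4 * (f (fst z) * g (mix (cos t) (sin t) z) *
      (\<Sum>b\<in>Basis. dir_deriv b f (fst z) * dir_deriv b g (mix (cos t) (sin t) z))))) (at t)" for t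
    using rotation_derivative[OF sq, of t] by (simp add: \<phi>_def[abs_def] sum_distrib_left mult_ac)
  then have \<phi>': "(\<phi> has_real_derivative - 4 * sin t * D t) (at t)" for t
    unfolding gexp_cmult D_def[symmetric] by (simp add: mult_ac)
  have carre: "carre (\<lambda>z. f (fst z)) (\<lambda>z. g (mix c s z)) z
      = c * (\<Sum>b\<in>Basis. dir_deriv b f (fst z) * dir_deriv b g (mix c s z))" for c s z
    by (simp add: carre_def sum_Basis_prod dir_deriv_fst dir_deriv_mix p sum_distrib_left mult_ac)
  have ef: "eigen k (\<lambda>z :: 'a \<times> 'a. f (fst z))"
    using eigen_mix[OF f, of 1 0] by (simp add: mix_def)
  have eg: "eigen l (\<lambda>z. g (mix (cos t) (sin t) z))" for t
    by (rule eigen_mix[OF g]) simp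
  have D: "gexp (\<lambda>z. f (fst z) * g (mix (cos t) (sin t) z) *
      carre (\<lambda>z. f (fst z)) (\<lambda>z. g (mix (cos t) (sin t) z)) z) = cos t * D t" for t
    unfolding carre D_def gexp_cmult[symmetric] by (simp add: mult_ac)
  \<comment> \<open>The factor \<open>cos t\<close> vanishes at \<open>\<pi>/2\<close>, so the sign of \<open>D\<close> is obtained only inside the interval.\<close>
  have D_nonneg: "0 \<le> D t" if "0 < t" "t < pi / 2" for t
  proof -
    have "0 < cos t" using that by (intro cos_gt_zero)
    with eigen_carre_nonneg[OF ef eg, of t] show ?thesis by (simp add: D zero_le_mult_iff)
  qed
  have mono: "\<phi> t \<le> \<phi> s" if "0 \<le> s" "s \<le> t" "t \<le> pi / 2" for s t
  proof (rule DERIV_nonpos_imp_decreasing_open[of s t \<phi>])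
    show "\<exists>y. (\<phi> has_real_derivative y) (at x) \<and> y \<le> 0" if "s < x" "x < t" for x
      using \<phi>'[of x] D_nonneg[of x] sin_ge_zero[of x] that \<open>0 \<le> s\<close> \<open>t \<le> pi / 2\<close> pi_gt_zero
      by (intro exI[of _ "- 4 * sin x * D x"]) simp
    show "continuous_on {s..t} \<phi>"
      using \<phi>' by (meson DERIV_isCont continuous_at_imp_continuous_on)
  qed fact
  have 0: "\<phi> 0 = gexp (\<lambda>x. (f x)\<^sup>2 * (g x)\<^sup>2)"
    using gexp_pair[OF real_polynomial_function.intros(4)[OF sq] real_polynomial_function.intros(2)[of 1]]
    by (simp add: \<phi>_def mix_def gexp_one)
  have 1: "\<phi> (pi / 2) = gexp (\<lambda>x. (f x)\<^sup>2) * gexp (\<lambda>x. (g x)\<^sup>2)"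
    using gexp_pair[OF sq] by (simp add: \<phi>_def mix_def)
  show "gexp (\<lambda>x. (f x)\<^sup>2) * gexp (\<lambda>x. (g x)\<^sup>2) \<le> gexp (\<lambda>x. (f x)\<^sup>2 * (g x)\<^sup>2)"
    using mono[of 0 "pi / 2"] pi_ge_zero by (simp add: 0 1)
  assume "gexp (\<lambda>x. (f x)\<^sup>2) * gexp (\<lambda>x. (g x)\<^sup>2) = gexp (\<lambda>x. (f x)\<^sup>2 * (g x)\<^sup>2)"
  then have const: "\<phi> t = \<phi> 0" if "0 \<le> t" "t \<le> pi / 2" for t
    using mono[of 0 t] mono[of t "pi / 2"] that by (simp add: 0 1)
  \<comment> \<open>Any interior angle would do; at \<open>\<pi>/4\<close> both sine and cosine are nonzero.\<close>
  have "- 4 * sin (pi / 4) * D (pi / 4) = 0"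
  proof (rule DERIV_local_const[OF \<phi>'])
    show "0 < pi / 4" by simp
    show "\<forall>s. \<bar>pi / 4 - s\<bar> < pi / 4 \<longrightarrow> \<phi> (pi / 4) = \<phi> s"
    proof (intro allI impI)
      fix s assume "\<bar>pi / 4 - s\<bar> < pi / 4"
      then have "0 \<le> s" "s \<le> pi / 2" by (auto simp: abs_if split: if_splits)
      then show "\<phi> (pi / 4) = \<phi> s" using const[of "pi / 4"] const[of s] by simp
    qed
  qed
  then have "D (pi / 4) = 0" by (simp add: sin_45)
  with D[of "pi / 4"] have "carre (\<lambda>z. f (fst z)) (\<lambda>z. g (mix (cos (pi / 4)) (sin (pi / 4)) z)) z = 0" for z
    by (intro eigen_carre_zero[OF ef eg]) simp
  then have zero: "(\<Sum>b\<in>Basis. dir_deriv b f (fst z) * dir_deriv b g (mix (cos (pi / 4)) (sin (pi / 4)) z)) = 0" for z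
    by (simp add: carre cos_45)
  \<comment> \<open>The second component is chosen such that the mixture hits the prescribed point \<open>y\<close>.\<close>
  have "mix (cos (pi / 4)) (sin (pi / 4)) (x, (1 / sin (pi / 4)) *\<^sub>R (y - cos (pi / 4) *\<^sub>R x)) = y"
    by (simp add: mix_def sin_45)
  with zero[of "(x, (1 / sin (pi / 4)) *\<^sub>R (y - cos (pi / 4) *\<^sub>R x))"]
  show "(\<Sum>b\<in>Basis. dir_deriv b f x * dir_deriv b g y) = 0" by simp
qed

section \<open>Gradients and orthonormal coordinates\<close>

definition gradient :: "('a::euclidean_space \<Rightarrow> real) \<Rightarrow> 'a \<Rightarrow> 'a" where
  "gradient f x = (\<Sum>b\<in>Basis. dir_deriv b f x *\<^sub>R b)"

lemma inner_gradient: "rpoly f \<Longrightarrow> v \<bullet> gradient f x = dir_deriv v f x"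
  by (simp add: gradient_def inner_sum_right dir_deriv_expand[of f v] mult.commute)

lemma inner_gradient_gradient:
  "gradient f x \<bullet> gradient g y = (\<Sum>b\<in>Basis. dir_deriv b f x * dir_deriv b g y)"
  by (subst euclidean_inner) (simp add: gradient_def)

lemma constant_orthogonal_to_gradients:
  assumes f: "rpoly f" and w: "\<And>y. w \<bullet> gradient f y = 0"
  shows "f (x + w) = f x"
proof -
  have "((\<lambda>t. f (x + t *\<^sub>R w)) has_real_derivative 0) (at t)" for t
  proof -
    have "((\<lambda>t. x + t *\<^sub>R w) has_derivative (\<lambda>t. t *\<^sub>R w)) (at t)"
      by (auto intro!: derivative_eq_intros)
    from has_derivative_compose[OF this dir_deriv_has_derivative[OF f]]
    show ?thesis using w
      by (simp add: has_field_derivative_def dir_deriv_scale f inner_gradient[symmetric] lambda_zero[symmetric])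
  qed
  then have "(\<lambda>t. f (x + t *\<^sub>R w)) 1 = (\<lambda>t. f (x + t *\<^sub>R w)) 0" by (intro DERIV_isconst_all) simp
  then show ?thesis by simp
qed

text \<open>
  Orthonormal bases of the pairwise orthogonal spans together form an orthonormal family, which
  extends to an orthonormal basis of the whole space; \<open>E i\<close> collects the indices of those basis vectors
  that come from the span of \<open>V i\<close>.
\<close>

lemma adapted_orthonormal_basis:
  fixes V :: "nat \<Rightarrow> (real ^ 'n) set"
  assumes orth: "\<And>i j v w. i \<in> I \<Longrightarrow> j \<in> I \<Longrightarrow> i \<noteq> j \<Longrightarrow> v \<in> V i \<Longrightarrow> w \<in> V j \<Longrightarrow> v \<bullet> w = 0"
  obtains e :: "'n \<Rightarrow> real ^ 'n" and E :: "nat \<Rightarrow> 'n set"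
  where "\<And>j l. e j \<bullet> e l = (if j = l then 1 else 0)"
    and "\<And>x. (\<Sum>j\<in>UNIV. (x \<bullet> e j) *\<^sub>R e j) = x"
    and "disjoint_family_on E I"
    and "\<And>i. i \<in> I \<Longrightarrow> V i \<subseteq> span (e ` E i)"
proof -
  have "\<exists>B. B \<subseteq> span (V i) \<and> pairwise orthogonal B \<and> (\<forall>x\<in>B. norm x = 1) \<and> span B = span (V i)" for i
    by (rule orthonormal_basis_subspace[OF subspace_span[of "V i"]]) blast
  then have "\<exists>B. \<forall>i. B i \<subseteq> span (V i) \<and> pairwise orthogonal (B i) \<and> (\<forall>x\<in>B i. norm x = 1) \<and>
      span (B i) = span (V i)"
    by (intro choice allI)
  then obtain B where B: "\<And>i. B i \<subseteq> span (V i)" "\<And>i. pairwise orthogonal (B i)"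
      "\<And>i x. x \<in> B i \<Longrightarrow> norm x = 1" "\<And>i. span (B i) = span (V i)"
    by blast
  have B_orth: "orthogonal v w" if "i \<in> I" "j \<in> I" "i \<noteq> j" "v \<in> B i" "w \<in> B j" for i j v w
  proof -
    have "orthogonal v' w" if "v' \<in> V i" for v'
      using orth[OF \<open>i \<in> I\<close> \<open>j \<in> I\<close> \<open>i \<noteq> j\<close> that] subsetD[OF B(1) \<open>w \<in> B j\<close>]
      by (intro orthogonal_to_span[of w "V j"]) (auto simp: orthogonal_def)
    then have "orthogonal w v"
      using subsetD[OF B(1) \<open>v \<in> B i\<close>] by (intro orthogonal_to_span[of v "V i"]) (auto simp: orthogonal_commute)
    then show ?thesis by (simp add: orthogonal_commute)
  qed
  define S where "S = (\<Union>i\<in>I. B i)"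
  have S_norm: "norm x = 1" if "x \<in> S" for x
    using that B(3) by (auto simp: S_def)
  have S_orth: "pairwise orthogonal S"
  proof (rule pairwiseI)
    fix v w assume "v \<in> S" "w \<in> S" "v \<noteq> w"
    then obtain i j where ij: "i \<in> I" "v \<in> B i" "j \<in> I" "w \<in> B j" by (auto simp: S_def)
    show "orthogonal v w"
    proof (cases "i = j")
      case True
      with ij \<open>v \<noteq> w\<close> B(2)[of i] show ?thesis by (auto simp: pairwise_def)
    next
      case False
      then show ?thesis using B_orth ij by blast
    qed
  qed
  obtain U where U: "U \<inter> insert 0 S = {}" "pairwise orthogonal (S \<union> U)" "span (S \<union> U) = span (S \<union> UNIV)"
    using orthogonal_extension_strong[OF S_orth] by blast
  have nz: "0 \<notin> S \<union> U" using U(1) S_norm[of 0] by auto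
  \<comment> \<open>Normalising leaves the unit vectors in \<open>S\<close> unchanged, so \<open>S\<close> is a subset of \<open>C\<close>.\<close>
  define C where "C = (\<lambda>x. inverse (norm x) *\<^sub>R x) ` (S \<union> U)"
  have fin: "finite (S \<union> U)"
    using pairwise_orthogonal_independent[OF U(2) nz] by (rule independent_imp_finite)
  have C: "pairwise orthogonal C" "\<And>x. x \<in> C \<Longrightarrow> norm x = 1" "span C = UNIV" "finite C"
  proof -
    show "pairwise orthogonal C"
      using U(2) unfolding C_def pairwise_image by (auto simp: pairwise_def orthogonal_clauses)
    show "norm x = 1" if "x \<in> C" for x
    proof -
      from that obtain y where y: "y \<in> S \<union> U" "x = inverse (norm y) *\<^sub>R y"
        unfolding C_def by blast
      then have "y \<noteq> 0" using nz by blast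
      with y show ?thesis by simp
    qed
    show "span C = UNIV"
      unfolding C_def using nz U(3) by (subst span_image_scale[OF fin]) auto
    show "finite C" unfolding C_def using fin by simp
  qed
  have "0 \<notin> C" using C(2) by force
  then have "dim (UNIV :: (real ^ 'n) set) = card C"
    using C(3) pairwise_orthogonal_independent[OF C(1)] by (intro dim_eq_card) simp_all
  then have "card C = CARD('n)" by simp
  then obtain e :: "'n \<Rightarrow> real ^ 'n" where e: "bij_betw e UNIV C"
    using C(4) finite_same_card_bij[of "UNIV :: 'n set" C] by auto
  have SC: "S \<subseteq> C"
  proof
    fix x assume "x \<in> S"
    then show "x \<in> C" unfolding C_def using S_norm by (intro image_eqI[of _ _ x]) auto
  qed
  define E where "E i = {j. e j \<in> B i}" for i
  show thesis
  proof
    show "e j \<bullet> e l = (if j = l then 1 else 0)" for j l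
    proof (cases "j = l")
      case True
      have "norm (e l) = 1" using C(2) e by (auto simp: bij_betw_def)
      with True show ?thesis by (simp add: norm_eq_1)
    next
      case False
      then have "e j \<noteq> e l" using e by (auto simp: bij_betw_def inj_on_def)
      then show ?thesis using C(1) e False by (auto simp: bij_betw_def pairwise_def orthogonal_def)
    qed
    show "(\<Sum>j\<in>UNIV. (x \<bullet> e j) *\<^sub>R e j) = x" for x
    proof -
      have "(\<Sum>j\<in>UNIV. (x \<bullet> e j) *\<^sub>R e j) = (\<Sum>v\<in>C. (x \<bullet> v) *\<^sub>R v)"
        by (rule sum.reindex_bij_betw[OF e])
      also have "\<dots> = x" by (rule orthonormal_basis_expand) (use C in auto)
      finally show ?thesis .
    qed
    show "disjoint_family_on E I"
      unfolding disjoint_family_on_def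
    proof (intro ballI impI)
      fix i j assume ij: "i \<in> I" "j \<in> I" "i \<noteq> j"
      have False if "l \<in> E i" "l \<in> E j" for l
        using B_orth[OF ij, of "e l" "e l"] B(3)[of "e l" i] that by (auto simp: E_def orthogonal_def)
      then show "E i \<inter> E j = {}" by blast
    qed
    show "V i \<subseteq> span (e ` E i)" if "i \<in> I" for i
    proof -
      have "e ` E i = B i"
        using SC that bij_betw_imp_surj_on[OF e] unfolding E_def S_def by blast
      then show ?thesis using B(4)[of i] span_superset[of "V i"] by simp
    qed
  qed
qed

text \<open>
  The difference between \<open>x\<close> and its projection to the span of the \<open>e j\<close> with \<open>j \<in> E\<close> is orthogonal
  to all gradients, so \<open>f\<close> is constant along it.
\<close>

lemma depends_on_coordinates:
  fixes e :: "'n::finite \<Rightarrow> 'a::euclidean_space"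
  assumes e: "\<And>j l. e j \<bullet> e l = (if j = l then 1 else 0)"
    and f: "rpoly f" and grad: "\<And>y. gradient f y \<in> span (e ` E)"
  shows "f x = f (\<Sum>j\<in>E. (x \<bullet> e j) *\<^sub>R e j)"
proof -
  let ?p = "\<Sum>j\<in>E. (x \<bullet> e j) *\<^sub>R e j"
  have "(x - ?p) \<bullet> e l = 0" if "l \<in> E" for l
    using that by (simp add: inner_diff_left inner_sum_left e if_distrib sum.delta cong: if_cong)
  then have "orthogonal (x - ?p) (gradient f y)" for y
    by (intro orthogonal_to_span[OF grad]) (auto simp: orthogonal_def)
  then have "f (?p + (x - ?p)) = f ?p"
    by (intro constant_orthogonal_to_gradients f) (simp add: orthogonal_def)
  then show ?thesis by simp
qed

lemma real_polys_sum:
  "finite A \<Longrightarrow> (\<And>j. j \<in> A \<Longrightarrow> f j \<in> real_polys Y E) \<Longrightarrow> (\<lambda>\<omega>. \<Sum>j\<in>A. f j \<omega>) \<in> real_polys Y E"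
  by (induction A rule: finite_induct) (auto intro: real_polys.intros)

lemma rpoly_in_real_polys:
  fixes e :: "'n::finite \<Rightarrow> 'a::real_normed_vector"
  assumes "rpoly f"
  shows "(\<lambda>\<omega>. f (\<Sum>j\<in>E. Y j \<omega> *\<^sub>R e j)) \<in> real_polys Y E"
  using assms
proof (induction rule: real_polynomial_function.induct)
  case (linear f)
  interpret bounded_linear f by fact
  have "(\<lambda>\<omega>. \<Sum>j\<in>E. Y j \<omega> * f (e j)) \<in> real_polys Y E"
    by (intro real_polys_sum real_polys.mult real_polys.var real_polys.const) auto
  then show ?case by (simp add: sum scaleR)
qed (auto intro: real_polys.intros)

section \<open>The standard Gaussian vector\<close>

lemma Basis_cart: "(Basis :: (real ^ 'n) set) = range (\<lambda>j. axis j 1)"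
  by (auto simp: Basis_vec_def)

lemma inj_axis_one: "inj (\<lambda>j. axis j (1::real))"
  by (auto simp: inj_on_def axis_eq_axis)

lemma partial_deriv_eq_dir_deriv:
  fixes f :: "real ^ 'n \<Rightarrow> real"
  assumes f: "rpoly f"
  shows "partial_deriv j f = dir_deriv (axis j 1) f"
proof
  fix x :: "real ^ 'n"
  have "((\<lambda>t. x + t *\<^sub>R axis j 1) has_derivative (\<lambda>t. t *\<^sub>R axis j 1)) (at 0)"
    by (auto intro!: derivative_eq_intros)
  then have "((\<lambda>t. f (x + t *\<^sub>R axis j 1)) has_derivative (\<lambda>t. dir_deriv (t *\<^sub>R axis j 1) f x)) (at 0)"
    using has_derivative_compose[OF _ dir_deriv_has_derivative[OF f]] by fastforce
  then have "((\<lambda>t. f (x + t *\<^sub>R axis j 1)) has_field_derivative dir_deriv (axis j 1) f x) (at 0)"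
    by (simp add: has_field_derivative_def dir_deriv_scale[OF f] mult.commute[of _ "dir_deriv (axis j 1) f x"])
  then show "partial_deriv j f x = dir_deriv (axis j 1) f x"
    unfolding partial_deriv_def by (rule DERIV_imp_deriv)
qed

lemma OU_ker_eigen:
  assumes "f \<in> OU_ker k" shows "eigen k f"
proof -
  have f: "rpoly f" and *: "OU f x = - real k * f x" for x
    using assms by (auto simp: OU_ker_def eq_neg_iff_add_eq_0)
  have "x \<bullet> grad f x = (\<Sum>j\<in>UNIV. x $ j * dir_deriv (axis j 1) f x)" for x
    by (simp add: grad_def inner_vec_def partial_deriv_eq_dir_deriv f)
  then have "ou f x = OU f x" for x
    by (simp add: ou_def OU_def laplacian_def Basis_cart sum.reindex[OF inj_axis_one] sum_subtractf
        partial_deriv_eq_dir_deriv f rpoly_dir_deriv inner_axis)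
  with f * show ?thesis by (simp add: eigen_def)
qed

lemma std_gaussian_density_eq: "std_gaussian_density = gauss_density"
proof
  fix x :: "real ^ 'n"
  have norm: "(norm x)\<^sup>2 = (\<Sum>j\<in>UNIV. (x $ j)\<^sup>2)"
    unfolding power2_norm_eq_inner inner_vec_def by (simp add: power2_eq_square)
  have "gauss_density x = (\<Prod>j\<in>UNIV. exp (- (x $ j)\<^sup>2 / 2) / sqrt (2 * pi))"
    by (simp add: gauss_density_def Basis_cart prod.reindex[OF inj_axis_one] inner_axis std_normal_density_def)
  also have "\<dots> = exp (\<Sum>j\<in>UNIV. - (x $ j)\<^sup>2 / 2) / sqrt (2 * pi) ^ CARD('n)"
    by (simp add: prod_dividef exp_sum)
  also have "(\<Sum>j\<in>UNIV. - (x $ j)\<^sup>2 / 2) = - (norm x)\<^sup>2 / 2"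
    by (simp add: norm sum_negf sum_divide_distrib)
  finally show "std_gaussian_density x = gauss_density x" by (simp add: std_gaussian_density_def)
qed

lemma
  fixes X :: "'a \<Rightarrow> real ^ 'n"
  assumes X: "distributed M lborel X std_gaussian_density" and p: "rpoly p"
  shows integrable_rpoly_gaussian: "integrable M (\<lambda>\<omega>. p (X \<omega>))"
    and integral_rpoly_gaussian: "(\<integral>\<omega>. p (X \<omega>) \<partial>M) = gexp p"
proof -
  have m: "p \<in> borel_measurable lborel" using measurable_rpoly[OF p] by simp
  have nn: "0 \<le> gauss_density x" for x :: "real ^ 'n" using gauss_density_pos by (rule less_imp_le)
  note X' = X[unfolded std_gaussian_density_eq]
  show "integrable M (\<lambda>\<omega>. p (X \<omega>))"
    using distributed_integrable[OF X' m nn] gint_rpoly[OF p] by (simp add: gint_def)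
  show "(\<integral>\<omega>. p (X \<omega>) \<partial>M) = gexp p"
    using distributed_integral[OF X' m nn] by (simp add: gexp_def)
qed

section \<open>Independence of sums of squared chaotic polynomials\<close>

text \<open>
  The covariance of the two sums is the double sum of the covariances of the single squares.
  These are nonnegative, so they all vanish if their sum does.
\<close>

lemma sums_of_squares_cov_zero:
  fixes F G :: "nat \<Rightarrow> 'a::euclidean_space \<Rightarrow> real"
  assumes fin: "finite I" "finite J"
    and F: "\<And>k. k \<in> I \<Longrightarrow> eigen k (F k)" and G: "\<And>l. l \<in> J \<Longrightarrow> eigen l (G l)"
    and cov: "gexp (\<lambda>x. (\<Sum>k\<in>I. (F k x)\<^sup>2) * (\<Sum>l\<in>J. (G l x)\<^sup>2))
      = gexp (\<lambda>x. \<Sum>k\<in>I. (F k x)\<^sup>2) * gexp (\<lambda>x. \<Sum>l\<in>J. (G l x)\<^sup>2)"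
    and kl: "k \<in> I" "l \<in> J"
  shows "gradient (F k) x \<bullet> gradient (G l) y = 0"
proof -
  let ?c = "\<lambda>k l. gexp (\<lambda>x. (F k x)\<^sup>2 * (G l x)\<^sup>2) - gexp (\<lambda>x. (F k x)\<^sup>2) * gexp (\<lambda>x. (G l x)\<^sup>2)"
  have p: "rpoly (\<lambda>x. (F k x)\<^sup>2)" if "k \<in> I" for k
    using F[OF that] by (auto simp: eigen_def)
  have q: "rpoly (\<lambda>x. (G l x)\<^sup>2)" if "l \<in> J" for l
    using G[OF that] by (auto simp: eigen_def)
  have "gexp (\<lambda>x. (\<Sum>k\<in>I. (F k x)\<^sup>2) * (\<Sum>l\<in>J. (G l x)\<^sup>2))
      = gexp (\<lambda>x. \<Sum>k\<in>I. \<Sum>l\<in>J. (F k x)\<^sup>2 * (G l x)\<^sup>2)"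
    by (simp add: sum_product)
  also have "\<dots> = (\<Sum>k\<in>I. \<Sum>l\<in>J. gexp (\<lambda>x. (F k x)\<^sup>2 * (G l x)\<^sup>2))"
    using p q by (simp add: gexp_sum fin real_polynomial_function_sum real_polynomial_function.intros(4))
  moreover have "gexp (\<lambda>x. \<Sum>k\<in>I. (F k x)\<^sup>2) * gexp (\<lambda>x. \<Sum>l\<in>J. (G l x)\<^sup>2)
      = (\<Sum>k\<in>I. \<Sum>l\<in>J. gexp (\<lambda>x. (F k x)\<^sup>2) * gexp (\<lambda>x. (G l x)\<^sup>2))"
    using p q by (simp add: gexp_sum fin sum_product)
  ultimately have sum0: "(\<Sum>k\<in>I. \<Sum>l\<in>J. ?c k l) = 0"
    using cov by (simp add: sum_subtractf)
  have nn: "0 \<le> ?c k l" if "k \<in> I" "l \<in> J" for k l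
    using squares_cov_nonneg[OF F[OF that(1)] G[OF that(2)]] by simp
  have "(\<Sum>l\<in>J. ?c k l) = 0"
    using sum0 kl(1) nn by (subst (asm) sum_nonneg_eq_0_iff) (auto intro: sum_nonneg fin)
  then have "?c k l = 0"
    using kl nn by (subst (asm) sum_nonneg_eq_0_iff) (auto intro: fin)
  then show ?thesis
    unfolding inner_gradient_gradient by (intro squares_cov_zero[OF F[OF kl(1)] G[OF kl(2)]]) simp
qed

theorem theorem1p7:
  fixes M :: "'a measure" and X :: "'a \<Rightarrow> real ^ 'n"
    and q :: nat and P :: "nat \<Rightarrow> real ^ 'n \<Rightarrow> real"
  assumes "prob_space M"
    and "distributed M lborel X std_gaussian_density"
    and "\<And>i. i \<in> {1..q} \<Longrightarrow> P i \<in> class_C"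
    and "\<And>i j. i \<in> {1..q} \<Longrightarrow> j \<in> {1..q} \<Longrightarrow> i \<noteq> j \<Longrightarrow>
           prob_space.indep_var M borel (\<lambda>\<omega>. P i (X \<omega>)) borel (\<lambda>\<omega>. P j (X \<omega>))"
  shows "\<exists>(T :: real ^ 'n \<Rightarrow> real ^ 'n) (E :: nat \<Rightarrow> 'n set).
           orthogonal_transformation T \<and>
           disjoint_family_on E {1..q} \<and>
           (\<forall>i\<in>{1..q}. (\<lambda>\<omega>. P i (X \<omega>)) \<in> real_polys (\<lambda>j \<omega>. T (X \<omega>) $ j) (E i))"
proof -
  interpret prob_space M by fact
  note X = assms(2)
  have "\<exists>m F. (\<forall>k\<in>{1..m}. F k \<in> OU_ker k) \<and> P i = (\<lambda>x. \<Sum>k=1..m. (F k x)\<^sup>2)" if "i \<in> {1..q}" for i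
    using assms(3)[OF that] unfolding class_C_def by blast
  then obtain m F where F: "\<And>i k. i \<in> {1..q} \<Longrightarrow> k \<in> {1..m i} \<Longrightarrow> F i k \<in> OU_ker k"
    and P: "\<And>i. i \<in> {1..q} \<Longrightarrow> P i = (\<lambda>x. \<Sum>k=1..m i. (F i k x)\<^sup>2)"
    by metis
  have eig: "eigen k (F i k)" if "i \<in> {1..q}" "k \<in> {1..m i}" for i k
    using F[OF that] by (rule OU_ker_eigen)
  have polyF: "rpoly (F i k)" if "i \<in> {1..q}" "k \<in> {1..m i}" for i k
    using eig[OF that] by (simp add: eigen_def)
  have polyP: "rpoly (P i)" if "i \<in> {1..q}" for i
    unfolding P[OF that] using polyF[OF that]
    by (intro real_polynomial_function_sum real_polynomial_function_power) auto
  \<comment> \<open>The spans of the \<open>V i\<close> will be the blocks of the new coordinate system.\<close>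
  define V where "V i = {gradient (F i k) x | k x. k \<in> {1..m i}}" for i
  have orth: "v \<bullet> w = 0" if ij: "i \<in> {1..q}" "j \<in> {1..q}" "i \<noteq> j" and vw: "v \<in> V i" "w \<in> V j" for i j v w
  proof -
    have "gexp (\<lambda>x. P i x * P j x) = gexp (P i) * gexp (P j)"
      using indep_var_lebesgue_integral[OF assms(4)[OF ij]
          integrable_rpoly_gaussian[OF X polyP[OF ij(1)]] integrable_rpoly_gaussian[OF X polyP[OF ij(2)]]]
        integral_rpoly_gaussian[OF X polyP[OF ij(1)]] integral_rpoly_gaussian[OF X polyP[OF ij(2)]]
        integral_rpoly_gaussian[OF X real_polynomial_function.intros(4)[OF polyP[OF ij(1)] polyP[OF ij(2)]]]
      by simp
    then have cov: "gexp (\<lambda>x. (\<Sum>k=1..m i. (F i k x)\<^sup>2) * (\<Sum>l=1..m j. (F j l x)\<^sup>2))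
        = gexp (\<lambda>x. \<Sum>k=1..m i. (F i k x)\<^sup>2) * gexp (\<lambda>x. \<Sum>l=1..m j. (F j l x)\<^sup>2)"
      by (simp only: P[OF ij(1)] P[OF ij(2)])
    obtain k x where v: "v = gradient (F i k) x" "k \<in> {1..m i}" using vw(1) by (auto simp: V_def)
    obtain l y where w: "w = gradient (F j l) y" "l \<in> {1..m j}" using vw(2) by (auto simp: V_def)
    show ?thesis
      unfolding v(1) w(1)
      by (rule sums_of_squares_cov_zero[OF _ _ eig[OF ij(1)] eig[OF ij(2)] cov v(2) w(2)]) auto
  qed
  obtain e :: "'n \<Rightarrow> real ^ 'n" and E :: "nat \<Rightarrow> 'n set"
    where e: "\<And>j l. e j \<bullet> e l = (if j = l then 1 else 0)"
      and expand: "\<And>x. (\<Sum>j\<in>UNIV. (x \<bullet> e j) *\<^sub>R e j) = x"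
      and disj: "disjoint_family_on E {1..q}"
      and span: "\<And>i. i \<in> {1..q} \<Longrightarrow> V i \<subseteq> span (e ` E i)"
    by (rule adapted_orthonormal_basis[of "{1..q}" V], rule orth, assumption+) blast
  define T where "T x = (\<chi> j. x \<bullet> e j)" for x
  have "orthogonal_transformation T"
    unfolding orthogonal_transformation_def
  proof (intro conjI allI)
    show "linear T"
      by (rule linearI) (simp_all add: T_def vec_eq_iff inner_add_left)
    fix v w
    have "v \<bullet> w = (\<Sum>j\<in>UNIV. (v \<bullet> e j) *\<^sub>R e j) \<bullet> w" by (simp only: expand)
    also have "\<dots> = T v \<bullet> T w" unfolding inner_vec_def[of "T v"] by (simp add: inner_sum_left T_def inner_commute[of w])
    finally show "T v \<bullet> T w = v \<bullet> w" ..
  qed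
  moreover have "(\<lambda>\<omega>. P i (X \<omega>)) \<in> real_polys (\<lambda>j \<omega>. T (X \<omega>) $ j) (E i)" if i: "i \<in> {1..q}" for i
  proof -
    have "F i k x = F i k (\<Sum>j\<in>E i. (x \<bullet> e j) *\<^sub>R e j)" if k: "k \<in> {1..m i}" for k x
      using span[OF i] k by (intro depends_on_coordinates[OF e polyF[OF i k]]) (auto simp: V_def)
    then have "P i x = P i (\<Sum>j\<in>E i. (x \<bullet> e j) *\<^sub>R e j)" for x
      unfolding P[OF i] by (intro sum.cong refl arg_cong[where f = "\<lambda>t. t\<^sup>2"])
    then have "(\<lambda>\<omega>. P i (X \<omega>)) = (\<lambda>\<omega>. P i (\<Sum>j\<in>E i. (T (X \<omega>) $ j) *\<^sub>R e j))"
      by (auto simp: T_def)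
    also have "\<dots> \<in> real_polys (\<lambda>j \<omega>. T (X \<omega>) $ j) (E i)"
      by (rule rpoly_in_real_polys[OF polyP[OF i]])
    finally show ?thesis .
  qed
  ultimately show ?thesis using disj by blast
qed

end
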